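(* Let $m\ge2$ and let $\alpha_0=0,\alpha_1,\dots,\alpha_m$ be $m+1$ different rational numbers, $\overline\alpha=(\alpha_0,\dots,\alpha_m)^T$. With $g_1$ and $\tilde g_3$ as in the context, there is a real number $\hat A_{AKT}(\overline\alpha)$ with $$\hat A_{AKT}(\overline\alpha)\le\sqrt m+\left(4+\sqrt m+8m\right)\sqrt{\log(2g_1\tilde g_3)}$$ such that $$\left|\beta_0+\beta_1e^{\alpha_1}+\cdots+\beta_me^{\alpha_m}\right|>\hat H^{-1-\hat A_{AKT}(\overline\alpha)/\sqrt{\log\log\hat H}}$$ for all $\overline\beta=(\beta_0,\dots,\beta_m)^T\in\mathbb{Z}^{m+1}\setminus\{\overline0\}$ and all real $H_i\ge\max\{1,|\beta_i|\}$ ($1\le i\le m$) for which $\hat H=\prod_{i=1}^mH_i\ge\hat H_{0,AKT}(\overline\alpha)$, where $$\log\hat H_{0,AKT}(\overline\alpha)=56m^2\log(2g_1\tilde g_3)\,e^{111m^2\log(2g_1\tilde g_3)} .$$ Furthermore, $\hat A_{AKT}(\overline\alpha)\le\hat A_{SA}(\overline\alpha)$, where $$\hat A_{SA}(\overline\alpha)=16m^2+m\log(2m)+39m+12+\left(8+\frac4m+\frac1{3m^2}\right)\log(2g_1\tilde g_3).$$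
   Context: Write $\alpha_j=x_j/y_j$ in lowest terms with $x_j\in\mathbb{Z}$, $y_j\in\mathbb{Z}^+$ ($j=0,\dots,m$). Then $g_1=\operatorname{lcm}(y_0,\dots,y_m)$, $g_3=\max_{0\le j\le m}|\alpha_j|$ and $\tilde g_3=\max\{1,g_3\}$. *)

theory Defs
  imports Complex_Main
begin

text \<open>
  The tuple of rationals is a function \<open>\<alpha> :: nat \<Rightarrow> rat\<close> of which only the values
  \<open>\<alpha> 0, \<dots>, \<alpha> m\<close> are used.  \<open>quotient_of\<close> yields the representation in lowest terms
  with positive denominator.
\<close>

definition g1 :: "nat \<Rightarrow> (nat \<Rightarrow> rat) \<Rightarrow> int" where
  "g1 m \<alpha> = Lcm ((\<lambda>j. snd (quotient_of (\<alpha> j))) ` {0..m})"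

definition g3 :: "nat \<Rightarrow> (nat \<Rightarrow> rat) \<Rightarrow> rat" where
  "g3 m \<alpha> = Max ((\<lambda>j. \<bar>\<alpha> j\<bar>) ` {0..m})"

definition g3_tilde :: "nat \<Rightarrow> (nat \<Rightarrow> rat) \<Rightarrow> rat" where
  "g3_tilde m \<alpha> = max 1 (g3 m \<alpha>)"

definition log_2g1g3 :: "nat \<Rightarrow> (nat \<Rightarrow> rat) \<Rightarrow> real" where
  "log_2g1g3 m \<alpha> = ln (2 * real_of_int (g1 m \<alpha>) * real_of_rat (g3_tilde m \<alpha>))"

definition A_SA :: "nat \<Rightarrow> (nat \<Rightarrow> rat) \<Rightarrow> real" where
  "A_SA m \<alpha> = 16 * real m ^ 2 + real m * ln (2 * real m) + 39 * real m + 12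
     + (8 + 4 / real m + 1 / (3 * real m ^ 2)) * log_2g1g3 m \<alpha>"

text \<open>The threshold is given through its logarithm, hence the outer exponential.\<close>

definition H0_AKT :: "nat \<Rightarrow> (nat \<Rightarrow> rat) \<Rightarrow> real" where
  "H0_AKT m \<alpha> =
     exp (56 * real m ^ 2 * log_2g1g3 m \<alpha> * exp (111 * real m ^ 2 * log_2g1g3 m \<alpha>))"

end

theory Submission
  imports Defs "HOL-Library.FuncSet" "Jordan_Normal_Form.Determinant"
    "HOL-Computational_Algebra.Polynomial_FPS"
begin

text \<open>
  Write \<open>\<alpha>\<^sub>j = a\<^sub>j / q\<close> with integers \<open>a\<^sub>j\<close>.  Siegel's lemma yields a polynomial
  \<open>A\<^sub>0(t) = \<Sum>\<^sub>h (n!/h!) c\<^sub>h t\<^sup>h\<close> of degree at most \<open>n\<close> with small integers \<open>c\<^sub>h\<close> such that the power series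
  \<open>A\<^sub>0(t) exp(a\<^sub>j t)\<close> has vanishing coefficients at \<open>n < N \<le> n + l\<^sub>j\<close> for every \<open>j\<close>; its truncation at
  degree \<open>n\<close> is \<open>A\<^sub>j\<close>.  These are simultaneous Pade approximations with weights \<open>l\<^sub>j\<close> proportional
  to \<open>ln H\<^sub>j\<close>, which is what makes the bound depend on the product of the \<open>H\<^sub>j\<close> only.
  Applying \<open>D - a\<^sub>j\<close> repeatedly gives further approximations of the same kind.  The determinant of the
  first \<open>m + 1\<close> of them is a nonzero polynomial of degree at most \<open>(m + 1) n\<close> that vanishes at \<open>0\<close> to
  order about \<open>m n + \<Sum>\<^sub>j l\<^sub>j\<close>, so that it cannot vanish to high order at \<open>1/q\<close>; hence one of the
  first few approximations gives a nonzero integer when inserted into the linear form.  Comparing this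
  integer with the linear form in exponentials, and balancing the height of the \<open>c\<^sub>h\<close> against the defect
  \<open>\<nu> = n + 1 - \<Sum>\<^sub>j l\<^sub>j\<close> (the optimum is \<open>\<nu>\<close> of order \<open>n \<cdot> sqrt (log (2 g\<^sub>1 g\<^sub>3) / log log H)\<close>), gives the
  exponent.
\<close>

section \<open>Siegel's lemma\<close>

text \<open>Pigeonhole: the box of vectors with entries from 0 to \<open>C\<close> has more elements
  than the system can take values on it, so two of them share a value and their difference is a
  solution. Starting the box at 0 keeps the differences within \<open>C\<close>.\<close>

lemma siegel_lemma:
  fixes a :: "'i \<Rightarrow> 'j \<Rightarrow> int" and B :: "'i \<Rightarrow> nat" and C :: nat
  assumes fin: "finite I" "finite J"
    and row: "\<And>i. i \<in> I \<Longrightarrow> (\<Sum>j\<in>J. \<bar>a i j\<bar>) \<le> int (B i)"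
    and pos: "\<And>i. i \<in> I \<Longrightarrow> B i \<ge> 1"
    and few: "(\<Prod>i\<in>I. B i) * (C + 1) ^ card I < (C + 1) ^ card J"
  obtains x where "\<exists>j\<in>J. x j \<noteq> 0" "\<And>j. j \<in> J \<Longrightarrow> \<bar>x j\<bar> \<le> int C"
    "\<And>i. i \<in> I \<Longrightarrow> (\<Sum>j\<in>J. a i j * x j) = 0"
proof -
  define V where "V = PiE J (\<lambda>_. {0..int C})"
  \<comment> \<open>On the box, row \<open>i\<close> takes values between \<open>- q i * C\<close>
    and \<open>p i * C\<close>, an interval of length at most \<open>B i * C\<close>.\<close>
  define p where "p i = (\<Sum>j\<in>J. max 0 (a i j))" for i
  define q where "q i = (\<Sum>j\<in>J. max 0 (- a i j))" for i
  define W where "W = PiE I (\<lambda>i. {- q i * int C..p i * int C})"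
  define f where "f x = restrict (\<lambda>i. \<Sum>j\<in>J. a i j * x j) I" for x
  have pq: "p i + q i \<le> int (B i)" "0 \<le> p i" "0 \<le> q i" if "i \<in> I" for i
  proof -
    have "p i + q i = (\<Sum>j\<in>J. \<bar>a i j\<bar>)"
      unfolding p_def q_def sum.distrib[symmetric] by (intro sum.cong) auto
    then show "p i + q i \<le> int (B i)" using row[OF that] by simp
  qed (auto simp: p_def q_def intro: sum_nonneg)
  have fW: "f ` V \<subseteq> W"
  proof (rule image_subsetI)
    fix x assume x: "x \<in> V"
    have "(\<Sum>j\<in>J. a i j * x j) \<in> {- q i * int C..p i * int C}" for i
    proof -
      have xj: "0 \<le> x j" "x j \<le> int C" if "j \<in> J" for j
        using x that by (auto simp: V_def PiE_iff)
      have "(\<Sum>j\<in>J. a i j * x j) \<le> (\<Sum>j\<in>J. max 0 (a i j) * int C)"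
      proof (rule sum_mono)
        fix j assume j: "j \<in> J"
        have "a i j * x j \<le> max 0 (a i j) * x j" using xj[OF j] by (intro mult_right_mono) auto
        also have "\<dots> \<le> max 0 (a i j) * int C" using xj[OF j] by (intro mult_left_mono) auto
        finally show "a i j * x j \<le> max 0 (a i j) * int C" .
      qed
      moreover have "(\<Sum>j\<in>J. - (max 0 (- a i j) * int C)) \<le> (\<Sum>j\<in>J. a i j * x j)"
      proof (rule sum_mono)
        fix j assume j: "j \<in> J"
        have "- a i j * x j \<le> max 0 (- a i j) * x j" using xj[OF j] by (intro mult_right_mono) auto
        also have "\<dots> \<le> max 0 (- a i j) * int C" using xj[OF j] by (intro mult_left_mono) auto
        finally show "- (max 0 (- a i j) * int C) \<le> a i j * x j" by simp
      qed
      ultimately show ?thesis by (simp add: p_def q_def sum_distrib_right sum_negf)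
    qed
    then show "f x \<in> W" unfolding f_def W_def by simp
  qed
  have finW: "finite W" unfolding W_def using fin by (intro finite_PiE) auto
  have "card W = (\<Prod>i\<in>I. card {- q i * int C..p i * int C})"
    unfolding W_def by (rule card_PiE[OF fin(1)])
  also have "\<dots> \<le> (\<Prod>i\<in>I. B i * (C + 1))"
  proof (rule prod_mono)
    fix i assume i: "i \<in> I"
    \<comment> \<open>The interval holds one integer more than its length; \<open>B i\<close> being
      at least 1 makes room for it in \<open>B i * (C + 1)\<close>.\<close>
    have "p i * int C + q i * int C + 1 \<le> int (B i) * int C + int (B i)"
      using mult_right_mono[OF pq(1)[OF i], of "int C"] pos[OF i] by (simp add: distrib_right)
    then show "0 \<le> card {- q i * int C..p i * int C} \<and> card {- q i * int C..p i * int C} \<le> B i * (C + 1)"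
      by (simp add: nat_le_iff algebra_simps)
  qed
  also have "\<dots> = (\<Prod>i\<in>I. B i) * (C + 1) ^ card I"
    by (simp only: prod.distrib prod_constant)
  also have "\<dots> < (C + 1) ^ card J" by (rule few)
  also have "\<dots> = card V" unfolding V_def by (simp add: card_PiE[OF fin(2)] nat_add_distrib)
  finally have "card W < card V" .
  then have "card (f ` V) < card V" using card_mono[OF finW fW] by simp
  then have "\<not> inj_on f V" by (rule pigeonhole)
  then obtain x y where xy: "x \<in> V" "y \<in> V" "f x = f y" "x \<noteq> y" by (auto simp: inj_on_def)
  show thesis
  proof (rule that[of "\<lambda>j. x j - y j"])
    show "\<exists>j\<in>J. x j - y j \<noteq> 0"
    proof (rule ccontr)
      assume "\<not> ?thesis"
      then have "x = y" using xy(1,2) unfolding V_def by (intro PiE_ext) auto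
      with xy(4) show False by simp
    qed
    show "\<bar>x j - y j\<bar> \<le> int C" if "j \<in> J" for j
    proof -
      have "x j \<in> {0..int C}" "y j \<in> {0..int C}" using xy(1,2) that by (auto simp: V_def PiE_iff)
      then show ?thesis by auto
    qed
    show "(\<Sum>j\<in>J. a i j * (x j - y j)) = 0" if "i \<in> I" for i
      using fun_cong[OF xy(3), of i] that by (simp add: f_def right_diff_distrib sum_subtractf)
  qed
qed

section \<open>Determinants\<close>

text \<open>Each term of the Leibniz formula takes one entry from every column. This is how
  vanishing of the columns, at 0 or elsewhere, becomes vanishing of the determinant.\<close>

lemma prod_dvd_det:
  fixes A :: "'a :: comm_ring_1 mat"
  assumes A: "A \<in> carrier_mat n n"
    and d: "\<And>i j. i < n \<Longrightarrow> j < n \<Longrightarrow> d j dvd A $$ (i, j)"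
  shows "(\<Prod>j<n. d j) dvd det A"
  unfolding det_def'[OF A]
proof (rule dvd_sum)
  fix p assume "p \<in> {p. p permutes {0..<n}}"
  then have p: "p permutes {0..<n}" by simp
  have "(\<Prod>j<n. d j) = (\<Prod>i = 0..<n. d (p i))"
    using prod.permute[OF p, of d] by (simp add: atLeast0LessThan o_def)
  also have "\<dots> dvd (\<Prod>i = 0..<n. A $$ (i, p i))"
    using permutes_in_image[OF p] by (intro prod_dvd_prod d) auto
  finally show "(\<Prod>j<n. d j) dvd signof p * (\<Prod>i = 0..<n. A $$ (i, p i))" by (rule dvd_mult)
qed

lemma coeff_prod_sum_degree_bounds:
  fixes p :: "'i \<Rightarrow> 'a :: comm_semiring_1 poly"
  assumes "finite I" "\<And>i. i \<in> I \<Longrightarrow> degree (p i) \<le> d i"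
  shows "degree (\<Prod>i\<in>I. p i) \<le> (\<Sum>i\<in>I. d i)"
    and "coeff (\<Prod>i\<in>I. p i) (\<Sum>i\<in>I. d i) = (\<Prod>i\<in>I. coeff (p i) (d i))"
proof -
  have "degree (\<Prod>i\<in>I. p i) \<le> (\<Sum>i\<in>I. d i) \<and>
      coeff (\<Prod>i\<in>I. p i) (\<Sum>i\<in>I. d i) = (\<Prod>i\<in>I. coeff (p i) (d i))"
    using assms
  proof (induction rule: finite_induct)
    case (insert i I)
    have IH: "degree (\<Prod>i\<in>I. p i) \<le> (\<Sum>i\<in>I. d i)"
      "coeff (\<Prod>i\<in>I. p i) (\<Sum>i\<in>I. d i) = (\<Prod>i\<in>I. coeff (p i) (d i))"
      using insert.IH insert.prems by auto
    have di: "degree (p i) \<le> d i" using insert.prems by simp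
    have "degree (p i * (\<Prod>i\<in>I. p i)) \<le> d i + (\<Sum>i\<in>I. d i)"
      by (rule order.trans[OF degree_mult_le]) (intro add_mono di IH)
    moreover have "coeff (p i * (\<Prod>i\<in>I. p i)) (d i + (\<Sum>i\<in>I. d i))
        = coeff (p i) (d i) * coeff (\<Prod>i\<in>I. p i) (\<Sum>i\<in>I. d i)"
      unfolding coeff_mult
    proof (subst sum.remove[of _ "d i"])
      show "coeff (p i) (d i) * coeff (prod p I) (d i + sum d I - d i) +
        (\<Sum>k\<in>{..d i + sum d I} - {d i}. coeff (p i) k * coeff (prod p I) (d i + sum d I - k))
        = coeff (p i) (d i) * coeff (prod p I) (sum d I)"
      proof -
        have "coeff (p i) k * coeff (prod p I) (d i + sum d I - k) = 0"
          if "k \<in> {..d i + sum d I} - {d i}" for k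
        proof (cases "k < d i")
          case True
          then have "degree (prod p I) < d i + sum d I - k" using IH(1) by linarith
          then show ?thesis by (simp add: coeff_eq_0)
        next
          case False
          then have "degree (p i) < k" using di that by auto
          then show ?thesis by (simp add: coeff_eq_0)
        qed
        then have "(\<Sum>k\<in>{..d i + sum d I} - {d i}. coeff (p i) k * coeff (prod p I) (d i + sum d I - k)) = 0"
          by (intro sum.neutral) blast
        then show ?thesis by simp
      qed
    qed auto
    ultimately show ?case using insert.hyps IH(2) by simp
  qed simp
  then show "degree (\<Prod>i\<in>I. p i) \<le> (\<Sum>i\<in>I. d i)"
    "coeff (\<Prod>i\<in>I. p i) (\<Sum>i\<in>I. d i) = (\<Prod>i\<in>I. coeff (p i) (d i))" by auto
qed

text \<open>The bounds depend on the column only, so all terms of the Leibniz formula share the same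
  degree bound, and taking the coefficient there commutes with the products.\<close>

lemma degree_coeff_det:
  fixes A :: "'a :: comm_ring_1 poly mat"
  assumes A: "A \<in> carrier_mat n n"
    and d: "\<And>i j. i < n \<Longrightarrow> j < n \<Longrightarrow> degree (A $$ (i, j)) \<le> d j"
  shows "degree (det A) \<le> (\<Sum>j<n. d j)"
    and "coeff (det A) (\<Sum>j<n. d j) = det (mat n n (\<lambda>(i, j). coeff (A $$ (i, j)) (d j)))"
proof -
  have sumd: "(\<Sum>j<n. d j) = (\<Sum>i = 0..<n. d (p i))" if "p permutes {0..<n}" for p
    using sum.permute[OF that, of d] by (simp add: atLeast0LessThan o_def)
  have deg: "degree (A $$ (i, p i)) \<le> d (p i)" if "p permutes {0..<n}" "i \<in> {0..<n}" for i p
    using permutes_in_image[OF that(1)] that(2) by (intro d) auto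
  have sgn: "(signof p :: 'a poly) = [:signof p:]" for p :: "nat \<Rightarrow> nat"
    by (auto simp: sign_def one_pCons)
  show "degree (det A) \<le> (\<Sum>j<n. d j)"
    unfolding det_def'[OF A]
  proof (rule degree_sum_le)
    show "finite {p. p permutes {0..<n}}" by (rule finite_permutations) simp
    fix p assume "p \<in> {p. p permutes {0..<n}}"
    then have p: "p permutes {0..<n}" by simp
    show "degree (signof p * (\<Prod>i = 0..<n. A $$ (i, p i))) \<le> (\<Sum>j<n. d j)"
      unfolding sgn sumd[OF p] using deg[OF p]
      by (auto intro!: order.trans[OF degree_smult_le] coeff_prod_sum_degree_bounds(1))
  qed
  have B: "mat n n (\<lambda>(i, j). coeff (A $$ (i, j)) (d j)) \<in> carrier_mat n n" by simp
  show "coeff (det A) (\<Sum>j<n. d j) = det (mat n n (\<lambda>(i, j). coeff (A $$ (i, j)) (d j)))"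
    unfolding det_def'[OF A] det_def'[OF B] coeff_sum
  proof (rule sum.cong[OF refl])
    fix p assume "p \<in> {p. p permutes {0..<n}}"
    then have p: "p permutes {0..<n}" by simp
    have "coeff (\<Prod>i = 0..<n. A $$ (i, p i)) (\<Sum>j<n. d j) = (\<Prod>i = 0..<n. coeff (A $$ (i, p i)) (d (p i)))"
      unfolding sumd[OF p] using deg[OF p] by (intro coeff_prod_sum_degree_bounds(2)) auto
    also have "\<dots> = (\<Prod>i = 0..<n. mat n n (\<lambda>(i, j). coeff (A $$ (i, j)) (d j)) $$ (i, p i))"
      using permutes_in_image[OF p] by (intro prod.cong) auto
    finally show "coeff (signof p * (\<Prod>i = 0..<n. A $$ (i, p i))) (\<Sum>j<n. d j)
      = signof p * (\<Prod>i = 0..<n. mat n n (\<lambda>(i, j). coeff (A $$ (i, j)) (d j)) $$ (i, p i))"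
      unfolding sgn by simp
  qed
qed

text \<open>A kernel vector of the transpose would be the coefficient list of a nonzero polynomial
  of degree below \<open>n\<close> with the \<open>n\<close> distinct roots
  \<open>b j\<close>.\<close>

lemma det_vandermonde_nonzero:
  fixes b l :: "nat \<Rightarrow> 'a :: idom"
  assumes inj: "inj_on b {..<n}" and l: "\<And>j. j < n \<Longrightarrow> l j \<noteq> 0"
  shows "det (mat n n (\<lambda>(i, j). b j ^ i * l j)) \<noteq> 0"
proof
  let ?A = "mat n n (\<lambda>(i, j). b j ^ i * l j)"
  assume "det ?A = 0"
  then have "det (transpose_mat ?A) = 0" by (subst det_transpose) auto
  moreover have T: "transpose_mat ?A \<in> carrier_mat n n" by simp
  ultimately obtain v where v: "v \<in> carrier_vec n" "v \<noteq> 0\<^sub>v n" "transpose_mat ?A *\<^sub>v v = 0\<^sub>v n"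
    using det_0_iff_vec_prod_zero[OF T] by auto
  define p where "p = (\<Sum>i<n. monom (v $ i) i)"
  have cp: "coeff p i = v $ i" if "i < n" for i
    using that by (simp add: p_def coeff_sum coeff_monom)
  obtain i where i: "i < n" "v $ i \<noteq> 0" using v(1,2) by (metis carrier_vecD eq_vecI index_zero_vec)
  then have p0: "p \<noteq> 0" using cp by (metis coeff_0)
  have dp: "degree p < n"
  proof -
    have "degree p \<le> n - 1" unfolding p_def
      by (intro degree_sum_le) (auto intro!: order.trans[OF degree_monom_le])
    with i show ?thesis by simp
  qed
  have root: "poly p (b j) = 0" if j: "j < n" for j
  proof -
    have "0 = (transpose_mat ?A *\<^sub>v v) $ j" using v(3) j by simp
    also have "\<dots> = (\<Sum>i<n. b j ^ i * l j * v $ i)"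
      using j v(1) by (simp add: scalar_prod_def atLeast0LessThan)
    also have "\<dots> = l j * poly p (b j)"
      by (simp add: p_def poly_sum poly_monom sum_distrib_left algebra_simps)
    finally show ?thesis using l[OF j] by simp
  qed
  have "n = card (b ` {..<n})" using card_image[OF inj] by simp
  also have "\<dots> \<le> card {x. poly p x = 0}"
    using root by (intro card_mono poly_roots_finite p0) auto
  also have "\<dots> \<le> degree p" by (rule card_poly_roots_bound[OF p0])
  finally show False using dp by simp
qed

section \<open>A zero estimate\<close>

text \<open>This is exp(a t) D(exp(- a t) p), the derivative conjugated by an exponential; its
  powers therefore correspond to ordinary derivatives of exp(- a t) p.\<close>

definition twisted_deriv :: "'a \<Rightarrow> 'a poly \<Rightarrow> 'a :: {comm_ring_1, semiring_no_zero_divisors} poly" where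
  "twisted_deriv a p = pderiv p - smult a p"

definition fps_twisted_deriv :: "'a \<Rightarrow> 'a fps \<Rightarrow> 'a :: comm_ring_1 fps" where
  "fps_twisted_deriv a f = fps_deriv f - fps_const a * f"

lemma fps_of_poly_twisted_deriv_power:
  "fps_of_poly ((twisted_deriv a ^^ k) p) = (fps_twisted_deriv a ^^ k) (fps_of_poly p)"
  by (induction k) (simp_all add: twisted_deriv_def fps_twisted_deriv_def
      fps_of_poly_diff fps_of_poly_pderiv fps_of_poly_smult)

text \<open>The derivative contributes nothing at a degree bound \<open>d\<close>, so each step
  multiplies that coefficient by \<open>- a\<close>. These powers are the source of the Vandermonde
  determinant.\<close>

lemma degree_coeff_twisted_deriv_power:
  fixes p :: "'a :: idom poly"
  assumes "degree p \<le> d"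
  shows "degree ((twisted_deriv a ^^ k) p) \<le> d \<and>
    coeff ((twisted_deriv a ^^ k) p) d = (- a) ^ k * coeff p d"
proof (induction k)
  case (Suc k)
  let ?q = "(twisted_deriv a ^^ k) p"
  have "degree (pderiv ?q) \<le> d"
    by (rule degree_le) (use Suc in \<open>auto simp: coeff_pderiv coeff_eq_0\<close>)
  moreover have "coeff (pderiv ?q) d = 0"
    using Suc by (simp add: coeff_pderiv coeff_eq_0)
  ultimately show ?case using Suc
    by (auto simp: twisted_deriv_def[of a ?q] intro!: degree_diff_le order.trans[OF degree_smult_le])
qed (use assms in simp)

lemma twisted_deriv_power_pcompose:
  "(twisted_deriv a ^^ k) (pcompose p [:x, 1:]) = pcompose ((twisted_deriv a ^^ k) p) [:x, 1:]"
  by (induction k) (simp_all add: twisted_deriv_def pderiv_pcompose pcompose_diff pcompose_smult pderiv_pCons)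

lemma fps_twisted_deriv_power_diff:
  "(fps_twisted_deriv a ^^ k) (f - g) = (fps_twisted_deriv a ^^ k) f - (fps_twisted_deriv a ^^ k) g"
proof (induction k)
  case (Suc k)
  have "fps_twisted_deriv a (u - v) = fps_twisted_deriv a u - fps_twisted_deriv a v" for u v
    by (simp add: fps_twisted_deriv_def algebra_simps)
  with Suc show ?case by simp
qed simp

text \<open>An exponential factor shifts the parameter. With \<open>b = a\<close> the remainder of
  an approximation goes to the remainder of another one, in which the polynomial multiplied by the
  exponential is differentiated in the ordinary sense.\<close>

lemma fps_twisted_deriv_power_exp_mult:
  fixes f :: "'a :: field_char_0 fps"
  shows "(fps_twisted_deriv a ^^ k) (fps_exp b * f) = fps_exp b * (fps_twisted_deriv (a - b) ^^ k) f"
proof (induction k)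
  case (Suc k)
  have "fps_twisted_deriv a (fps_exp b * u) = fps_exp b * fps_twisted_deriv (a - b) u" for u :: "'a fps"
    by (simp add: fps_twisted_deriv_def algebra_simps flip: fps_const_sub)
  with Suc show ?case by simp
qed simp

lemma fps_twisted_deriv_0: "fps_twisted_deriv 0 = fps_deriv"
  by (simp add: fps_twisted_deriv_def fun_eq_iff)

lemma fps_deriv_power_sum: "(fps_deriv ^^ k) (\<Sum>j\<in>A. f j) = (\<Sum>j\<in>A. (fps_deriv ^^ k) (f j))"
  by (induction k) (simp_all add: fps_deriv_sum)

section \<open>Orders of vanishing\<close>

lemma fps_X_power_dvd_iff:
  fixes f :: "'a :: comm_ring_1 fps"
  shows "fps_X ^ r dvd f \<longleftrightarrow> (\<forall>i<r. fps_nth f i = 0)"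
proof
  assume f: "\<forall>i<r. fps_nth f i = 0"
  have "f = fps_X ^ r * fps_shift r f"
    by (rule fps_ext) (use f in \<open>simp add: fps_X_power_mult_nth\<close>)
  then show "fps_X ^ r dvd f" by (rule dvdI)
qed (auto simp: dvd_def fps_X_power_mult_nth)

lemma fps_X_power_dvd_fps_of_poly_iff:
  fixes p :: "'a :: comm_ring_1 poly"
  shows "fps_X ^ r dvd fps_of_poly p \<longleftrightarrow> monom 1 r dvd p"
  by (auto simp: fps_X_power_dvd_iff monom_1_dvd_iff')

text \<open>Each application costs at most one order of vanishing.\<close>

lemma fps_X_power_dvd_fps_twisted_deriv:
  fixes f :: "'a :: comm_ring_1 fps"
  assumes "fps_X ^ r dvd f"
  shows "fps_X ^ (r - k) dvd (fps_twisted_deriv a ^^ k) f"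
proof (induction k)
  case (Suc k)
  then show ?case
    by (auto simp: fps_X_power_dvd_iff fps_twisted_deriv_def)
qed (use assms in simp)

lemma comm_ring_hom_fps_of_poly: "comm_ring_hom (fps_of_poly :: 'a :: comm_ring_1 poly \<Rightarrow> 'a fps)"
  by unfold_locales (simp_all add: fps_of_poly_add fps_of_poly_mult)

lemma comm_ring_hom_pcompose: "comm_ring_hom (\<lambda>p. pcompose p (q :: 'a :: comm_ring_1 poly))"
  by unfold_locales (simp_all add: pcompose_add pcompose_mult pcompose_1)

lemma sum_order_le_degree:
  fixes p :: "'a :: field poly"
  assumes p: "p \<noteq> 0" and x: "x \<noteq> 0" and r: "monom 1 r dvd p" and s: "[:- x, 1:] ^ s dvd p"
  shows "r + s \<le> degree p"
proof -
  obtain q where q: "p = [:- x, 1:] ^ s * q" using s by (rule dvdE)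
  with p have q0: "q \<noteq> 0" by auto
  have "order 0 ([:- x, 1:] ^ s) = 0" by (rule order_0I) (use x in simp)
  then have "order 0 p = order 0 q" unfolding q using p q by (subst order_mult) auto
  moreover have "r \<le> order 0 p"
    using r p order_divides[of 0 r p] by (simp add: monom_altdef)
  moreover have "order 0 q \<le> degree q" by (rule order_degree[OF q0])
  moreover have "degree p = s + degree q"
    unfolding q using q0 by (subst degree_mult_eq) (auto simp: degree_power_eq)
  ultimately show ?thesis by simp
qed

section \<open>The determinant of the approximations\<close>

text \<open>With the factor exp(a_j t) taken out of column \<open>j\<close>, this is the Wronskian
  matrix of the functions exp(- a_j t) P_j. Row \<open>k\<close> holds the \<open>k\<close>-th
  derived approximation.\<close>

definition wronskian_mat :: "nat \<Rightarrow> (nat \<Rightarrow> real) \<Rightarrow> (nat \<Rightarrow> real poly) \<Rightarrow> real poly mat" where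
  "wronskian_mat N a P = mat N N (\<lambda>(k, j). (twisted_deriv (a j) ^^ k) (P j))"

lemma wronskian_mat_carrier [simp]: "wronskian_mat N a P \<in> carrier_mat N N"
  by (simp add: wronskian_mat_def)

text \<open>The coefficient at the maximal possible degree is a Vandermonde determinant in the \<open>- a\<^sub>j\<close>.\<close>

lemma det_wronskian_mat:
  fixes a :: "nat \<Rightarrow> real"
  assumes inj: "inj_on a {..<N}"
    and nz: "\<And>j. j < N \<Longrightarrow> P j \<noteq> 0" and deg: "\<And>j. j < N \<Longrightarrow> degree (P j) \<le> n"
  shows "det (wronskian_mat N a P) \<noteq> 0" and "degree (det (wronskian_mat N a P)) \<le> N * n"
proof -
  let ?W = "wronskian_mat N a P"
  \<comment> \<open>The exact degree of \<open>P j\<close> serves as column bound, rather than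
    \<open>n\<close>, so that the coefficients there involve the nonzero
    \<open>lead_coeff (P j)\<close>.\<close>
  have d: "degree (?W $$ (i, j)) \<le> degree (P j)" if "i < N" "j < N" for i j
    using that degree_coeff_twisted_deriv_power[of "P j" "degree (P j)" i "a j"]
    by (simp add: wronskian_mat_def)
  have "coeff (det ?W) (\<Sum>j<N. degree (P j)) = det (mat N N (\<lambda>(i, j). coeff (?W $$ (i, j)) (degree (P j))))"
    by (rule degree_coeff_det(2)[OF wronskian_mat_carrier d])
  also have "mat N N (\<lambda>(i, j). coeff (?W $$ (i, j)) (degree (P j)))
      = mat N N (\<lambda>(i, j). (- a j) ^ i * lead_coeff (P j))"
    using degree_coeff_twisted_deriv_power by (intro eq_matI) (auto simp: wronskian_mat_def)
  also have "det \<dots> \<noteq> 0"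
    by (rule det_vandermonde_nonzero) (use inj nz in \<open>auto simp: inj_on_def\<close>)
  finally show "det ?W \<noteq> 0" by auto
  have "degree (det ?W) \<le> (\<Sum>j<N. degree (P j))"
    by (rule degree_coeff_det(1)[OF wronskian_mat_carrier d])
  also have "\<dots> \<le> (\<Sum>j<N. n)" by (intro sum_mono deg) simp
  finally show "degree (det ?W) \<le> N * n" by simp
qed

text \<open>Subtracting \<open>exp(a\<^sub>j t)\<close> times column \<open>0\<close> from column \<open>j\<close> turns the latter into remainders.\<close>

lemma monom_dvd_det_wronskian_mat:
  assumes a0: "a 0 = 0"
    and approx: "\<And>j. 1 \<le> j \<Longrightarrow> j \<le> m \<Longrightarrow>
      fps_X ^ e j dvd fps_of_poly (P j) - fps_exp (a j) * fps_of_poly (P 0)"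
  shows "monom 1 (\<Sum>j=1..m. e j - m) dvd det (wronskian_mat (Suc m) a P)"
proof -
  let ?N = "Suc m" and ?W = "wronskian_mat (Suc m) a P"
  interpret h: comm_ring_hom "fps_of_poly :: real poly \<Rightarrow> real fps" by (rule comm_ring_hom_fps_of_poly)
  define A where "A = map_mat fps_of_poly ?W"
  \<comment> \<open>Right multiplication by the unipotent \<open>U\<close> performs the column
    operations without changing the determinant.\<close>
  define U where "U = mat ?N ?N (\<lambda>(i, j). if i = j then 1 else if i = 0 then - fps_exp (a j) else (0 :: real fps))"
  have A: "A \<in> carrier_mat ?N ?N" by (simp add: A_def)
  have U: "U \<in> carrier_mat ?N ?N" by (simp add: U_def)
  have "upper_triangular U" by (auto simp: U_def)
  then have "det U = prod_list (diag_mat U)" by (rule det_upper_triangular[OF _ U])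
  also have "diag_mat U = replicate ?N 1" by (rule nth_equalityI) (auto simp: diag_mat_def U_def simp del: upt_Suc replicate_Suc)
  finally have detU: "det U = 1" by simp
  \<comment> \<open>Row \<open>k\<close> has lost \<open>k\<close> orders, and \<open>k\<close> is
    at most \<open>m\<close>, so \<open>e j - m\<close> orders remain in all of column
    \<open>j\<close>. Column 0 is not a remainder and contributes nothing.\<close>
  define d :: "nat \<Rightarrow> real fps" where "d j = (if j = 0 then 1 else fps_X ^ (e j - m))" for j
  have "(\<Prod>j<?N. d j) dvd det (A * U)"
  proof (rule prod_dvd_det)
    show "A * U \<in> carrier_mat ?N ?N" using A U by simp
    fix k j assume k: "k < ?N" and j: "j < ?N"
    show "d j dvd (A * U) $$ (k, j)"
    proof (cases "j = 0")
      case False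
      have "(A * U) $$ (k, j) = (\<Sum>i = 0..<?N. A $$ (k, i) * U $$ (i, j))"
        using k j A U by (auto simp: scalar_prod_def)
      also have "\<dots> = (\<Sum>i \<in> {0, j}. A $$ (k, i) * U $$ (i, j))"
        using j by (intro sum.mono_neutral_right) (auto simp: U_def)
      also have "\<dots> = A $$ (k, j) - fps_exp (a j) * A $$ (k, 0)"
        using False j by (simp add: U_def)
      also have "\<dots> = (fps_twisted_deriv (a j) ^^ k) (fps_of_poly (P j))
          - fps_exp (a j) * (fps_twisted_deriv 0 ^^ k) (fps_of_poly (P 0))"
        using k j by (simp add: A_def wronskian_mat_def fps_of_poly_twisted_deriv_power a0)
      also have "\<dots> = (fps_twisted_deriv (a j) ^^ k) (fps_of_poly (P j) - fps_exp (a j) * fps_of_poly (P 0))"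
        by (simp add: fps_twisted_deriv_power_diff fps_twisted_deriv_power_exp_mult)
      finally have "fps_X ^ (e j - k) dvd (A * U) $$ (k, j)"
        using fps_X_power_dvd_fps_twisted_deriv[OF approx[of j]] False j by simp
      moreover have "fps_X ^ (e j - m) dvd fps_X ^ (e j - k)"
        using k by (intro le_imp_power_dvd) simp
      ultimately show ?thesis using False by (simp only: d_def if_False) (blast intro: dvd_trans)
    qed (simp add: d_def)
  qed
  also have "det (A * U) = fps_of_poly (det ?W)"
    using det_mult[OF A U] detU by (simp add: A_def)
  also have "(\<Prod>j<?N. d j) = d 0 * (\<Prod>j=1..m. d j)"
    by (subst prod.remove[of _ 0]) (auto intro!: arg_cong2[of _ _ _ _ "(*)"] prod.cong)
  also have "\<dots> = fps_X ^ (\<Sum>j=1..m. e j - m)"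
    by (simp add: d_def power_sum)
  finally show ?thesis by (simp add: fps_X_power_dvd_fps_of_poly_iff)
qed

text \<open>
  Around \<open>x\<close>, column \<open>j0\<close> may be replaced by the derivatives of \<open>\<Sum>\<^sub>j \<beta>\<^sub>j exp(- a\<^sub>j t) P\<^sub>j(x + t)\<close>,
  whose first \<open>K\<close> coefficients vanish by assumption.
\<close>

lemma linear_power_dvd_det_wronskian_mat:
  assumes j0: "j0 \<le> m" "\<beta> j0 \<noteq> 0"
    and van: "\<And>k. k < K \<Longrightarrow> (\<Sum>j\<le>m. \<beta> j * poly ((twisted_deriv (a j) ^^ k) (P j)) x) = 0"
  shows "[:- x, 1:] ^ (K - m) dvd det (wronskian_mat (Suc m) a P)"
proof -
  let ?N = "Suc m" and ?W = "wronskian_mat (Suc m) a P"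
  \<comment> \<open>Translation moves the point \<open>x\<close> to 0, where orders can be read off
    power series.\<close>
  define Q where "Q j = pcompose (P j) [:x, 1:]" for j
  interpret h: comm_ring_hom "fps_of_poly :: real poly \<Rightarrow> real fps" by (rule comm_ring_hom_fps_of_poly)
  interpret c': comm_ring_hom "\<lambda>p. pcompose p [:- x, 1 :: real:]" by (rule comm_ring_hom_pcompose)
  interpret c: comm_ring_hom "\<lambda>p. pcompose p [:x, 1 :: real:]" by (rule comm_ring_hom_pcompose)
  define A where "A = map_mat (\<lambda>p. fps_of_poly (pcompose p [:x, 1:])) ?W"
  have A: "A \<in> carrier_mat ?N ?N" by (simp add: A_def)
  have "A = map_mat fps_of_poly (map_mat (\<lambda>p. pcompose p [:x, 1:]) ?W)"
    by (rule eq_matI) (simp_all add: A_def)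
  then have detA: "det A = fps_of_poly (pcompose (det ?W) [:x, 1:])" by simp
  have Aij: "A $$ (k, j) = (fps_twisted_deriv (a j) ^^ k) (fps_of_poly (Q j))" if "k < ?N" "j < ?N" for k j
    using that by (simp add: A_def wronskian_mat_def Q_def twisted_deriv_power_pcompose
        flip: fps_of_poly_twisted_deriv_power)
  \<comment> \<open>By Cramer's rule, replacing column \<open>j0\<close> of \<open>A\<close> by
    \<open>A *\<^sub>v v\<close> multiplies the determinant by \<open>v $ j0\<close>, which is a
    unit among power series because \<open>\<beta> j0\<close> is nonzero.\<close>
  define v where "v = vec ?N (\<lambda>j. fps_const (\<beta> j) * fps_exp (- a j))"
  have v: "v \<in> carrier_vec ?N" by (simp add: v_def)
  \<comment> \<open>The entries of \<open>A *\<^sub>v v\<close> are the derivatives of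
    \<open>G\<close>, and the Taylor coefficients of \<open>G\<close> are, up to factorials, the
    sums assumed to vanish.\<close>
  define G where "G = (\<Sum>j\<le>m. fps_const (\<beta> j) * (fps_exp (- a j) * fps_of_poly (Q j)))"
  have const_deriv: "(fps_deriv ^^ k) (fps_const r * f) = fps_const r * (fps_deriv ^^ k) f" for k r and f :: "real fps"
    by (induction k) simp_all
  have Gk: "(fps_deriv ^^ k) G = (\<Sum>j\<le>m. fps_const (\<beta> j) * (fps_exp (- a j) * (fps_twisted_deriv (a j) ^^ k) (fps_of_poly (Q j))))" for k
  proof -
    have "(fps_deriv ^^ k) (fps_exp (- b) * f) = fps_exp (- b) * (fps_twisted_deriv b ^^ k) f" for b :: real and f
      using fps_twisted_deriv_power_exp_mult[where a = 0 and b = "- b"] by (simp add: fps_twisted_deriv_0)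
    then show ?thesis unfolding G_def fps_deriv_power_sum const_deriv by simp
  qed
  have "fps_nth G k = 0" if "k < K" for k
  proof -
    have "fact k * fps_nth G k = fps_nth ((fps_deriv ^^ k) G) 0" by (simp add: fps_0th_higher_deriv)
    also have "\<dots> = (\<Sum>j\<le>m. \<beta> j * poly ((twisted_deriv (a j) ^^ k) (P j)) x)"
    proof -
      have "coeff (pcompose p [:x, 1:]) 0 = poly p x" for p :: "real poly"
        using poly_pcompose[of p "[:x, 1:]" 0] by (simp add: poly_0_coeff_0)
      then show ?thesis
        by (simp add: Gk fps_sum_nth Q_def twisted_deriv_power_pcompose
            flip: fps_of_poly_twisted_deriv_power)
    qed
    finally show ?thesis using van[OF that] by simp
  qed
  then have G: "fps_X ^ K dvd G" by (simp add: fps_X_power_dvd_iff)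
  define d :: "nat \<Rightarrow> real fps" where "d j = (if j = j0 then fps_X ^ (K - m) else 1)" for j
  have "(\<Prod>j<?N. d j) dvd det (replace_col A (A *\<^sub>v v) j0)"
  proof (rule prod_dvd_det)
    show "replace_col A (A *\<^sub>v v) j0 \<in> carrier_mat ?N ?N" using A by (simp add: replace_col_def)
    fix k j assume k: "k < ?N" and j: "j < ?N"
    show "d j dvd replace_col A (A *\<^sub>v v) j0 $$ (k, j)"
    proof (cases "j = j0")
      case True
      have "replace_col A (A *\<^sub>v v) j0 $$ (k, j) = (\<Sum>i = 0..<?N. A $$ (k, i) * v $ i)"
        using True k j A v by (auto simp: replace_col_def scalar_prod_def)
      also have "\<dots> = (fps_deriv ^^ k) G"
        unfolding Gk using k by (intro sum.cong) (auto simp: Aij v_def)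
      finally have "fps_X ^ (K - k) dvd replace_col A (A *\<^sub>v v) j0 $$ (k, j)"
        using fps_X_power_dvd_fps_twisted_deriv[OF G, of k 0] by (simp add: fps_twisted_deriv_0)
      moreover have "fps_X ^ (K - m) dvd fps_X ^ (K - k)"
        using k by (intro le_imp_power_dvd) simp
      ultimately have "fps_X ^ (K - m) dvd replace_col A (A *\<^sub>v v) j0 $$ (k, j)"
        by (metis dvd_trans)
      moreover have "d j = fps_X ^ (K - m)" using True by (simp add: d_def)
      ultimately show ?thesis by simp
    qed (simp add: d_def)
  qed
  also have "det (replace_col A (A *\<^sub>v v) j0) = v $ j0 * det A"
    by (rule cramer_lemma_mat[OF A v]) (use j0 in simp)
  also have "(\<Prod>j<?N. d j) = fps_X ^ (K - m)"
    using j0 by (simp add: d_def)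
  finally have "fps_X ^ (K - m) dvd v $ j0 * det A" .
  then have "fps_X ^ (K - m) dvd fps_const (inverse (\<beta> j0)) * fps_exp (a j0) * (v $ j0 * det A)"
    by (rule dvd_mult)
  also have "\<dots> = det A"
  proof -
    have "v $ j0 = fps_const (\<beta> j0) * fps_exp (- a j0)" using j0(1) by (simp add: v_def)
    moreover have "fps_const (inverse (\<beta> j0)) * fps_const (\<beta> j0) = 1" using j0(2) by simp
    moreover have "fps_exp (a j0) * fps_exp (- a j0) = 1" using fps_exp_add_mult[of "a j0" "- a j0"] by simp
    ultimately show ?thesis by (smt (verit) mult.assoc mult.commute mult.left_commute mult_1_right)
  qed
  finally have "monom 1 (K - m) dvd pcompose (det ?W) [:x, 1:]"
    unfolding detA by (simp only: fps_X_power_dvd_fps_of_poly_iff)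
  then obtain q where q: "pcompose (det ?W) [:x, 1:] = monom 1 (K - m) * q" by (rule dvdE)
  \<comment> \<open>Translating back turns the power of the variable into a power of
    \<open>[:- x, 1:]\<close>.\<close>
  have "pcompose [:x, 1:] [:- x, 1:] = [:0, 1:]" by (simp add: pcompose_pCons)
  then have "pcompose (pcompose (det ?W) [:x, 1:]) [:- x, 1:] = det ?W"
    by (metis pcompose_assoc pcompose_idR)
  moreover have "pcompose (monom 1 (K - m)) [:- x, 1:] = [:- x, 1:] ^ (K - m)"
    using c'.hom_power[of "[:0, 1:]" "K - m"] by (simp add: monom_altdef pcompose_pCons)
  ultimately have "det ?W = [:- x, 1:] ^ (K - m) * pcompose q [:- x, 1:]"
    unfolding q pcompose_mult by simp
  then show ?thesis by (rule dvdI)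
qed

text \<open>If all \<open>K\<close> values vanished, the orders at 0 and at \<open>x\<close>
  together would exceed the degree of a nonzero determinant. The summand \<open>m\<close> in the
  condition on \<open>K\<close> pays for the orders lost in the rows at \<open>x\<close>.\<close>

lemma zero_estimate:
  fixes a :: "nat \<Rightarrow> real"
  assumes inj: "inj_on a {..m}" and a0: "a 0 = 0"
    and nz: "\<And>j. j \<le> m \<Longrightarrow> P j \<noteq> 0" and deg: "\<And>j. j \<le> m \<Longrightarrow> degree (P j) \<le> n"
    and approx: "\<And>j. 1 \<le> j \<Longrightarrow> j \<le> m \<Longrightarrow>
      fps_X ^ e j dvd fps_of_poly (P j) - fps_exp (a j) * fps_of_poly (P 0)"
    and x: "x \<noteq> 0" and \<beta>: "j0 \<le> m" "\<beta> j0 \<noteq> 0"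
    and K: "(m + 1) * n + m < (\<Sum>j=1..m. e j - m) + K"
  obtains k where "k < K" "(\<Sum>j\<le>m. \<beta> j * poly ((twisted_deriv (a j) ^^ k) (P j)) x) \<noteq> 0"
proof -
  have "\<exists>k<K. (\<Sum>j\<le>m. \<beta> j * poly ((twisted_deriv (a j) ^^ k) (P j)) x) \<noteq> 0"
  proof (rule ccontr)
    assume "\<not> ?thesis"
    then have van: "(\<Sum>j\<le>m. \<beta> j * poly ((twisted_deriv (a j) ^^ k) (P j)) x) = 0" if "k < K" for k
      using that by blast
    define D where "D = det (wronskian_mat (Suc m) a P)"
    have inj': "inj_on a {..<Suc m}" using inj by (simp only: lessThan_Suc_atMost)
    have nz': "P j \<noteq> 0" if "j < Suc m" for j
      using nz[of j] that by simp
    have deg': "degree (P j) \<le> n" if "j < Suc m" for j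
      using deg[of j] that by simp
    have D: "D \<noteq> 0" unfolding D_def using inj' nz' deg' by (rule det_wronskian_mat(1))
    have degD: "degree D \<le> Suc m * n" unfolding D_def using inj' nz' deg' by (rule det_wronskian_mat(2))
    have 1: "monom 1 (\<Sum>j=1..m. e j - m) dvd D"
      unfolding D_def using a0 approx
      by (rule monom_dvd_det_wronskian_mat[of a m e P])
    have 2: "[:- x, 1:] ^ (K - m) dvd D"
      unfolding D_def using \<beta> van
      by (rule linear_power_dvd_det_wronskian_mat[of j0 m \<beta> K a P x])
    have "(\<Sum>j=1..m. e j - m) + (K - m) \<le> degree D"
      using D x 1 2 by (rule sum_order_le_degree)
    then have "(\<Sum>j=1..m. e j - m) + (K - m) \<le> Suc m * n" using degD by (rule le_trans)
    moreover have "Suc m * n = (m + 1) * n" by simp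
    ultimately show False using K by linarith
  qed
  with that show thesis by blast
qed

section \<open>Simultaneous approximations to exponentials\<close>

text \<open>The hypothesis says that D exp(b t) is a majorant of \<open>f\<close>. Differentiation
  multiplies this majorant by \<open>b\<close>, and multiplication by the constant \<open>a\<close>
  multiplies it by the absolute value of \<open>a\<close>.\<close>

lemma fps_nth_twisted_deriv_power_bound:
  fixes f :: "real fps"
  assumes f: "\<And>N. \<bar>fps_nth f N\<bar> \<le> D * b ^ N / fact N" and b: "0 \<le> b"
  shows "\<bar>fps_nth ((fps_twisted_deriv a ^^ k) f) N\<bar> \<le> D * (b + \<bar>a\<bar>) ^ k * b ^ N / fact N"
proof (induction k arbitrary: N)
  case (Suc k)
  define g where "g = (fps_twisted_deriv a ^^ k) f"
  define E where "E = D * (b + \<bar>a\<bar>) ^ k"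
  have g: "\<bar>fps_nth g N\<bar> \<le> E * b ^ N / fact N" for N
    using Suc by (simp add: g_def E_def)
  have "\<bar>fps_nth ((fps_twisted_deriv a ^^ Suc k) f) N\<bar>
      = \<bar>(real N + 1) * fps_nth g (N + 1) - a * fps_nth g N\<bar>"
    by (simp add: g_def fps_twisted_deriv_def algebra_simps)
  also have "\<dots> \<le> (real N + 1) * \<bar>fps_nth g (N + 1)\<bar> + \<bar>a\<bar> * \<bar>fps_nth g N\<bar>"
    by (rule order.trans[OF abs_triangle_ineq4]) (simp add: abs_mult)
  also have "\<dots> \<le> (real N + 1) * (E * b ^ (N + 1) / fact (N + 1)) + \<bar>a\<bar> * (E * b ^ N / fact N)"
    by (intro add_mono mult_left_mono g) auto
  also have "(real N + 1) * (E * b ^ (N + 1) / fact (N + 1)) = E * b ^ (N + 1) / fact N"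
  proof -
    have "fact (N + 1) = (real N + 1) * fact N" by simp
    moreover have "real N + 1 \<noteq> 0" by linarith
    ultimately show ?thesis by (simp del: fact_Suc)
  qed
  finally show ?case by (simp add: E_def field_simps)
qed (use f in simp)

lemma poly_sums: "(\<lambda>N. coeff p N * x ^ N) sums poly p (x :: real)"
proof -
  have "(\<lambda>N. coeff p N * x ^ N) sums (\<Sum>N\<le>degree p. coeff p N * x ^ N)"
    by (rule sums_finite) (auto simp: coeff_eq_0)
  then show ?thesis by (simp add: poly_altdef)
qed

lemma fps_exp_mult_poly_sums:
  fixes x :: real
  shows "(\<lambda>N. fps_nth (fps_exp a * fps_of_poly p) N * x ^ N) sums (exp (a * x) * poly p x)"
proof -
  have e: "(\<lambda>N. fps_nth (fps_exp a) N * x ^ N) sums exp (a * x)"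
    using exp_converges[of "a * x"] by (simp add: power_mult_distrib scaleR_conv_of_real divide_inverse mult_ac)
  have "summable (\<lambda>N. norm (fps_nth (fps_exp a) N * x ^ N))"
    using summable_norm_exp[of "a * x"]
    by (simp add: power_mult_distrib abs_mult power_abs divide_inverse mult_ac)
  moreover have "summable (\<lambda>N. norm (coeff p N * x ^ N))"
    by (rule summable_finite[of "{..degree p}"]) (auto simp: coeff_eq_0)
  ultimately have "(\<lambda>N. \<Sum>i\<le>N. (fps_nth (fps_exp a) i * x ^ i) * (coeff p (N - i) * x ^ (N - i)))
      sums ((\<Sum>N. fps_nth (fps_exp a) N * x ^ N) * (\<Sum>N. coeff p N * x ^ N))"
    by (rule Cauchy_product_sums)
  also have "(\<lambda>N. \<Sum>i\<le>N. (fps_nth (fps_exp a) i * x ^ i) * (coeff p (N - i) * x ^ (N - i)))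
      = (\<lambda>N. fps_nth (fps_exp a * fps_of_poly p) N * x ^ N)"
  proof
    fix N
    have "(\<Sum>i\<le>N. (fps_nth (fps_exp a) i * x ^ i) * (coeff p (N - i) * x ^ (N - i)))
        = (\<Sum>i\<le>N. fps_nth (fps_exp a) i * coeff p (N - i) * x ^ N)"
    proof (rule sum.cong[OF refl])
      fix i assume "i \<in> {..N}"
      then have "x ^ N = x ^ i * x ^ (N - i)" by (simp flip: power_add)
      then show "(fps_nth (fps_exp a) i * x ^ i) * (coeff p (N - i) * x ^ (N - i))
          = fps_nth (fps_exp a) i * coeff p (N - i) * x ^ N" by simp
    qed
    then show "(\<Sum>i\<le>N. (fps_nth (fps_exp a) i * x ^ i) * (coeff p (N - i) * x ^ (N - i)))
        = fps_nth (fps_exp a * fps_of_poly p) N * x ^ N"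
      by (simp add: fps_mult_nth sum_distrib_right atMost_atLeast0)
  qed
  also have "(\<Sum>N. fps_nth (fps_exp a) N * x ^ N) = exp (a * x)" using e by (rule sums_unique[symmetric])
  also have "(\<Sum>N. coeff p N * x ^ N) = poly p x" using poly_sums by (rule sums_unique[symmetric])
  finally show ?thesis .
qed

text \<open>Since \<open>fact N0 * fact i \<le> fact (i + N0)\<close>, the tail of the majorant is
  at most its first term times a full exponential series.\<close>

lemma exp_tail_bound:
  fixes f :: "nat \<Rightarrow> real"
  assumes s: "f sums s" and z: "\<And>N. N < N0 \<Longrightarrow> f N = 0"
    and f: "\<And>N. \<bar>f N\<bar> \<le> D * r ^ N / fact N" and D: "0 \<le> D" and r: "0 \<le> r"
  shows "\<bar>s\<bar> \<le> D * r ^ N0 / fact N0 * exp r"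
proof -
  have sh: "(\<lambda>i. f (i + N0)) sums s"
    using sums_iff_shift'[of f N0 s] s z by simp
  have e: "(\<lambda>i. D * r ^ N0 / fact N0 * (r ^ i / fact i)) sums (D * r ^ N0 / fact N0 * exp r)"
    using exp_converges[of r] by (intro sums_mult) (simp add: divide_inverse mult.commute)
  have b: "\<bar>f (i + N0)\<bar> \<le> D * r ^ N0 / fact N0 * (r ^ i / fact i)" for i
  proof -
    have "(fact N0 * fact i :: nat) dvd fact (N0 + i)" by (rule fact_fact_dvd_fact)
    then have "(fact N0 * fact i :: nat) \<le> fact (N0 + i)" by (rule dvd_imp_le) simp
    then have "real (fact N0 * fact i) \<le> real (fact (N0 + i))" by (rule of_nat_mono)
    then have le: "(fact N0 * fact i :: real) \<le> fact (i + N0)" by (simp add: add.commute)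
    have "\<bar>f (i + N0)\<bar> \<le> D * r ^ (i + N0) / fact (i + N0)" by (rule f)
    also have "\<dots> \<le> D * r ^ (i + N0) / (fact N0 * fact i)"
      using le D r by (intro divide_left_mono) auto
    finally show ?thesis by (simp add: power_add mult_ac)
  qed
  have "s \<le> D * r ^ N0 / fact N0 * exp r"
    by (rule sums_le[OF _ sh e]) (use b abs_le_D1 in blast)
  moreover have "- s \<le> D * r ^ N0 / fact N0 * exp r"
    by (rule sums_le[OF _ sums_minus[OF sh] e]) (use b abs_le_D2 in blast)
  ultimately show ?thesis by (rule abs_leI)
qed

section \<open>Integrality\<close>

lemma twisted_deriv_power_Ints:
  fixes p :: "real poly"
  assumes "\<And>N. coeff p N \<in> \<int>" and "a \<in> \<int>"
  shows "coeff ((twisted_deriv a ^^ k) p) N \<in> \<int>"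
  by (induction k arbitrary: N) (use assms in \<open>auto simp: twisted_deriv_def coeff_pderiv\<close>)

lemma power_mult_poly_inverse_Ints:
  fixes p :: "real poly"
  assumes "\<And>N. coeff p N \<in> \<int>" and "degree p \<le> n" and q: "q \<in> \<int>" "q \<noteq> 0"
  shows "q ^ n * poly p (1 / q) \<in> \<int>"
proof -
  have "q ^ n * poly p (1 / q) = (\<Sum>i\<le>degree p. coeff p i * (q ^ n * (1 / q) ^ i))"
    by (simp add: poly_altdef sum_distrib_left mult_ac)
  also have "\<dots> = (\<Sum>i\<le>degree p. coeff p i * q ^ (n - i))"
    using assms(2) q(2) by (intro sum.cong) (auto simp: power_diff power_one_over)
  also have "\<dots> \<in> \<int>" using assms by (intro Ints_sum Ints_mult Ints_power) auto
  finally show ?thesis .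
qed

section \<open>Construction of the approximations\<close>

text \<open>The equations state that the coefficient of exp(a_j t) times the sum of (n!/h!) c_h t^h
  vanishes at degree \<open>N\<close>, scaled by N!/n! to have integer entries. There is one
  equation for each unit of the orders \<open>l j\<close> and there are \<open>n + 1\<close>
  unknowns, which gives the exponents in the condition on \<open>C\<close>.\<close>

lemma small_pade_coefficients:
  fixes a :: "nat \<Rightarrow> int" and l :: "nat \<Rightarrow> nat" and Q :: real
  assumes Q: "\<And>j. 1 \<le> j \<Longrightarrow> j \<le> m \<Longrightarrow> 1 + real_of_int \<bar>a j\<bar> \<le> Q" "1 \<le> Q"
    and l: "\<And>j. 1 \<le> j \<Longrightarrow> j \<le> m \<Longrightarrow> l j \<le> n"
    and M: "(\<Sum>j=1..m. l j) \<le> n"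
    and C: "Q ^ (2 * n * (\<Sum>j=1..m. l j)) < (real C + 1) ^ (n + 1 - (\<Sum>j=1..m. l j))"
  obtains c where "\<exists>h\<le>n. c h \<noteq> 0" "\<And>h. h \<le> n \<Longrightarrow> \<bar>c h\<bar> \<le> int C"
    "\<And>j N. 1 \<le> j \<Longrightarrow> j \<le> m \<Longrightarrow> n < N \<Longrightarrow> N \<le> n + l j \<Longrightarrow>
      (\<Sum>h\<le>n. int (N choose h) * a j ^ (N - h) * c h) = 0"
proof -
  define M where "M = (\<Sum>j=1..m. l j)"
  define I where "I = Sigma {1..m} (\<lambda>j. {n<..n + l j})"
  define B where "B i = (1 + nat \<bar>a (fst i)\<bar>) ^ snd i" for i :: "nat \<times> nat"
  have cardI: "card I = M" by (simp add: I_def M_def)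
  have row: "(\<Sum>h\<le>n. \<bar>int (snd i choose h) * a (fst i) ^ (snd i - h)\<bar>) \<le> int (B i)" if "i \<in> I" for i
  proof -
    obtain j N where i: "i = (j, N)" by (cases i)
    have N: "n < N" using that by (simp add: I_def i)
    have "(\<Sum>h\<le>n. \<bar>int (N choose h) * a j ^ (N - h)\<bar>) = (\<Sum>h\<le>n. int (N choose h) * \<bar>a j\<bar> ^ (N - h))"
      by (simp add: abs_mult power_abs)
    also have "\<dots> \<le> (\<Sum>h\<le>N. int (N choose h) * \<bar>a j\<bar> ^ (N - h))"
      using N by (intro sum_mono2) auto
    also have "\<dots> = (1 + \<bar>a j\<bar>) ^ N" by (simp add: binomial_ring)
    finally show ?thesis by (simp add: B_def i)
  qed
  have BQ: "real (B i) \<le> Q ^ (2 * n)" if "i \<in> I" for i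
  proof -
    obtain j N where i: "i = (j, N)" by (cases i)
    have N: "1 \<le> j" "j \<le> m" "N \<le> n + l j" using that by (auto simp: I_def i)
    have "real (B i) = (1 + real_of_int \<bar>a j\<bar>) ^ N" by (simp add: B_def i)
    also have "\<dots> \<le> Q ^ N" using Q(1)[OF N(1,2)] by (intro power_mono) auto
    \<comment> \<open>No order exceeds \<open>n\<close>, hence \<open>N \<le> 2 * n\<close>.\<close>
    also have "\<dots> \<le> Q ^ (2 * n)" using N l[OF N(1,2)] by (intro power_increasing Q) auto
    finally show ?thesis .
  qed
  have "real (\<Prod>i\<in>I. B i) \<le> (\<Prod>i\<in>I. Q ^ (2 * n))"
    unfolding of_nat_prod by (intro prod_mono) (use BQ in auto)
  also have "\<dots> = Q ^ (2 * n * M)" by (simp add: cardI power_mult)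
  also have "\<dots> < (real C + 1) ^ (n + 1 - M)" using C by (simp add: M_def)
  finally have "real (\<Prod>i\<in>I. B i) * (real C + 1) ^ M < (real C + 1) ^ (n + 1 - M) * (real C + 1) ^ M"
    by (intro mult_strict_right_mono) auto
  also have "\<dots> = (real C + 1) ^ (n + 1)"
    using M by (simp add: M_def flip: power_add)
  finally have "real ((\<Prod>i\<in>I. B i) * (C + 1) ^ M) < real ((C + 1) ^ (n + 1))"
    by (simp only: of_nat_mult of_nat_prod of_nat_power of_nat_add of_nat_1)
  then have few: "(\<Prod>i\<in>I. B i) * (C + 1) ^ card I < (C + 1) ^ card {..n}"
    unfolding cardI by (simp only: of_nat_less_iff card_atMost Suc_eq_plus1)
  have fin: "finite I" "finite {..n}" by (auto simp: I_def)
  have pos: "1 \<le> B i" for i by (simp add: B_def)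
  obtain c where c: "\<exists>h\<in>{..n}. c h \<noteq> 0" "\<And>h. h \<in> {..n} \<Longrightarrow> \<bar>c h\<bar> \<le> int C"
    "\<And>i. i \<in> I \<Longrightarrow> (\<Sum>h\<le>n. int (snd i choose h) * a (fst i) ^ (snd i - h) * c h) = 0"
    using siegel_lemma[OF fin row pos few] by blast
  show thesis
  proof (rule that[of c])
    show "(\<Sum>h\<le>n. int (N choose h) * a j ^ (N - h) * c h) = 0"
      if "1 \<le> j" "j \<le> m" "n < N" "N \<le> n + l j" for j N
      using c(3)[of "(j, N)"] that by (simp add: I_def)
  qed (use c in auto)
qed

text \<open>For a suitable \<open>k\<close> the form with coefficients \<open>\<beta> j\<close>,
  evaluated at the approximations at 1/q and scaled by \<open>q ^ n\<close>, is a nonzero integer.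
  The first summand of the bound comes from the linear form in exponentials, the second from the
  remainders.\<close>

lemma exists_nonvanishing_approximation:
  fixes a \<beta> :: "nat \<Rightarrow> int" and l :: "nat \<Rightarrow> nat" and q :: int and Q :: real
  assumes inj: "inj_on a {..m}" and a0: "a 0 = 0" and q: "q > 0"
    and Q: "\<And>j. 1 \<le> j \<Longrightarrow> j \<le> m \<Longrightarrow> 1 + real_of_int \<bar>a j\<bar> \<le> Q" "1 \<le> Q"
    and l: "\<And>j. 1 \<le> j \<Longrightarrow> j \<le> m \<Longrightarrow> l j \<le> n"
    and M: "(\<Sum>j=1..m. l j) \<le> n" and m: "m \<le> n"
    and C: "Q ^ (2 * n * (\<Sum>j=1..m. l j)) < (real C + 1) ^ (n + 1 - (\<Sum>j=1..m. l j))"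
    and \<beta>: "j0 \<le> m" "\<beta> j0 \<noteq> 0"
  obtains k where "k + (\<Sum>j=1..m. l j) \<le> n + m ^ 2"
    "1 \<le> q ^ n * (fact n * real C * exp 1 * \<bar>\<Sum>j\<le>m. \<beta> j * exp (a j / q)\<bar>)
      + q ^ n * (\<Sum>j=1..m. \<bar>real_of_int (\<beta> j)\<bar> * (fact n * real C * (1 + 2 * \<bar>real_of_int (a j)\<bar>) ^ k
          * ((1 + \<bar>real_of_int (a j)\<bar>) / q) ^ (n + l j + 1 - k) / fact (n + l j + 1 - k)
          * exp ((1 + \<bar>real_of_int (a j)\<bar>) / q)))"
proof -
  obtain c where c: "\<exists>h\<le>n. c h \<noteq> 0" "\<And>h. h \<le> n \<Longrightarrow> \<bar>c h\<bar> \<le> int C"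
    "\<And>j N. 1 \<le> j \<Longrightarrow> j \<le> m \<Longrightarrow> n < N \<Longrightarrow> N \<le> n + l j \<Longrightarrow>
      (\<Sum>h\<le>n. int (N choose h) * a j ^ (N - h) * c h) = 0"
    by (rule small_pade_coefficients[of m a Q l n C]) (use Q l M C in blast)+
  \<comment> \<open>The weights n!/h! cancel the factorials of the exponential series: the
    coefficients of \<open>F j\<close> are n!/N! times integers, hence integers up to degree
    \<open>n\<close>.\<close>
  define A0 where "A0 = (\<Sum>h\<le>n. monom (real_of_int (c h) * fact n / fact h) h)"
  have coeffA0: "coeff A0 h = (if h \<le> n then real_of_int (c h) * fact n / fact h else 0)" for h
    by (simp add: A0_def coeff_sum coeff_monom)
  have A0: "A0 \<noteq> 0"
  proof
    assume A0: "A0 = 0"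
    obtain h where h: "h \<le> n" "c h \<noteq> 0" using c(1) by blast
    then have "coeff A0 h \<noteq> 0" unfolding coeffA0 by simp
    with A0 show False by simp
  qed
  define F where "F j = fps_exp (real_of_int (a j)) * fps_of_poly A0" for j
  have F_nth: "fps_nth (F j) N = fact n / fact N * real_of_int (\<Sum>h\<le>n. int (N choose h) * a j ^ (N - h) * c h)" for j N
  proof -
    have "fps_nth (F j) N = (\<Sum>h\<le>N. coeff A0 h * (a j ^ (N - h) / fact (N - h)))"
      unfolding F_def by (subst mult.commute) (simp add: fps_mult_nth atMost_atLeast0)
    also have "\<dots> = (\<Sum>h\<in>{..N} \<inter> {..n}. coeff A0 h * (a j ^ (N - h) / fact (N - h)))"
      by (rule sum.mono_neutral_right) (auto simp: coeffA0)
    also have "\<dots> = (\<Sum>h\<in>{..N} \<inter> {..n}. fact n / fact N * real_of_int (int (N choose h) * a j ^ (N - h) * c h))"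
      by (intro sum.cong) (auto simp: coeffA0 binomial_fact)
    also have "\<dots> = (\<Sum>h\<le>n. fact n / fact N * real_of_int (int (N choose h) * a j ^ (N - h) * c h))"
      by (rule sum.mono_neutral_left) auto
    finally show ?thesis by (simp add: sum_distrib_left)
  qed
  have F_bound: "\<bar>fps_nth (F j) N\<bar> \<le> (fact n * real C) * (1 + \<bar>real_of_int (a j)\<bar>) ^ N / fact N" for j N
  proof -
    have "\<bar>\<Sum>h\<le>n. int (N choose h) * a j ^ (N - h) * c h\<bar> \<le> (\<Sum>h\<le>n. \<bar>int (N choose h) * a j ^ (N - h) * c h\<bar>)"
      by (rule sum_abs)
    also have "\<dots> \<le> (\<Sum>h\<le>n. int (N choose h) * \<bar>a j\<bar> ^ (N - h) * int C)"
      using c(2) by (intro sum_mono) (auto simp: abs_mult power_abs intro!: mult_left_mono)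
    \<comment> \<open>Either of \<open>n\<close> and \<open>N\<close> may be the larger; the range
      is first enlarged to contain both and then cut at \<open>N\<close>, beyond which the binomial
      coefficients vanish.\<close>
    also have "\<dots> \<le> (\<Sum>h\<le>n + N. int (N choose h) * \<bar>a j\<bar> ^ (N - h) * int C)"
      by (rule sum_mono2) auto
    also have "\<dots> = (\<Sum>h\<le>N. int (N choose h) * \<bar>a j\<bar> ^ (N - h) * int C)"
      by (rule sum.mono_neutral_right) auto
    also have "\<dots> = (1 + \<bar>a j\<bar>) ^ N * int C"
      by (simp add: binomial_ring sum_distrib_right)
    finally have "real_of_int \<bar>\<Sum>h\<le>n. int (N choose h) * a j ^ (N - h) * c h\<bar> \<le> real_of_int ((1 + \<bar>a j\<bar>) ^ N * int C)"
      by (simp only: of_int_le_iff)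
    then have "\<bar>real_of_int (\<Sum>h\<le>n. int (N choose h) * a j ^ (N - h) * c h)\<bar> \<le> (1 + \<bar>real_of_int (a j)\<bar>) ^ N * real C"
      by simp
    then have "fact n / fact N * \<bar>real_of_int (\<Sum>h\<le>n. int (N choose h) * a j ^ (N - h) * c h)\<bar>
        \<le> fact n / fact N * ((1 + \<bar>real_of_int (a j)\<bar>) ^ N * real C)"
      by (rule mult_left_mono) simp
    then show ?thesis unfolding F_nth abs_mult by (simp add: mult_ac)
  qed
  define P where "P j = (\<Sum>N\<le>n. monom (fps_nth (F j) N) N)" for j
  have coeffP: "coeff (P j) N = (if N \<le> n then fps_nth (F j) N else 0)" for j N
    by (simp add: P_def coeff_sum coeff_monom)
  have P0: "P 0 = A0"
    by (rule poly_eqI) (simp add: coeffP F_def a0 coeffA0)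
  have degP: "degree (P j) \<le> n" for j by (rule degree_le) (simp add: coeffP)
  have P_nz: "P j \<noteq> 0" for j
  proof
    assume P: "P j = 0"
    \<comment> \<open>A vanishing truncation would make \<open>F j\<close>, and then
      \<open>A0 = exp(- a_j t) F j\<close>, vanish to order \<open>n + 1\<close>, against the degree
      of the nonzero \<open>A0\<close>.\<close>
    have "fps_nth (F j) N = 0" if "N < Suc n" for N
      using arg_cong[OF P, of "\<lambda>p. coeff p N"] that by (simp add: coeffP)
    then have "fps_X ^ Suc n dvd F j" by (simp add: fps_X_power_dvd_iff del: power_Suc)
    then have "fps_X ^ Suc n dvd fps_exp (- real_of_int (a j)) * F j" by (rule dvd_mult)
    also have "fps_exp (- real_of_int (a j)) * F j = fps_of_poly A0"
    proof -
      have "fps_exp (- real_of_int (a j)) * fps_exp (real_of_int (a j)) = 1"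
        using fps_exp_add_mult[of "- real_of_int (a j)" "real_of_int (a j)"] by simp
      then show ?thesis unfolding F_def by (simp only: mult.assoc[symmetric] mult_1_left)
    qed
    finally have "\<forall>i<Suc n. coeff A0 i = 0" by (simp add: fps_X_power_dvd_iff del: power_Suc)
    then have "A0 = 0" by (intro poly_eqI) (auto simp: coeffA0)
    with A0 show False by simp
  qed
  define R where "R j = fps_of_poly (P j) - F j" for j
  have R_nth: "fps_nth (R j) N = (if N \<le> n then 0 else - fps_nth (F j) N)" for j N
    by (simp add: R_def coeffP)
  have R_ord: "fps_X ^ (n + l j + 1) dvd R j" if "1 \<le> j" "j \<le> m" for j
    unfolding fps_X_power_dvd_iff using c(3)[OF that] by (auto simp: R_nth F_nth)
  define M' where "M' = (\<Sum>j=1..m. l j)"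
  \<comment> \<open>This is the least number of derived approximations that the zero estimate admits
    for the orders \<open>n + l j + 1\<close>.\<close>
  define K where "K = n + m ^ 2 - M' + 1"
  have "(\<Sum>j=1..m. n + l j + 1 - m) + m * m = (\<Sum>j=1..m. (n + l j + 1 - m) + m)"
    by (simp add: sum.distrib)
  also have "\<dots> = (\<Sum>j=1..m. n + l j + 1)" using m by (intro sum.cong) auto
  also have "\<dots> = (\<Sum>j=1..m. l j + (n + 1))" by (simp add: ac_simps)
  also have "\<dots> = M' + (\<Sum>j=1..m. n + 1)" unfolding M'_def by (rule sum.distrib)
  also have "\<dots> = m * n + M' + m" by simp
  finally have K: "(m + 1) * n + m < (\<Sum>j=1..m. n + l j + 1 - m) + K"
    using M by (simp add: K_def M'_def power2_eq_square)
  have inj': "inj_on (\<lambda>j. real_of_int (a j)) {..m}" using inj by (auto simp: inj_on_def)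
  define x where "x = 1 / real_of_int q"
  have x: "x \<noteq> 0" "0 \<le> x" "x \<le> 1" using q by (auto simp: x_def)
  obtain k where k: "k < K"
    "(\<Sum>j\<le>m. real_of_int (\<beta> j) * poly ((twisted_deriv (real_of_int (a j)) ^^ k) (P j)) x) \<noteq> 0"
  proof (rule zero_estimate[OF inj', of P n "\<lambda>j. n + l j + 1" x j0 "\<lambda>j. real_of_int (\<beta> j)" K])
    show "fps_X ^ (n + l j + 1) dvd fps_of_poly (P j) - fps_exp (real_of_int (a j)) * fps_of_poly (P 0)"
      if "1 \<le> j" "j \<le> m" for j
      using R_ord[OF that] by (simp only: R_def F_def P0)
  qed (use a0 P_nz degP x \<beta> K in auto)
  define T where "T j = (twisted_deriv (real_of_int (a j)) ^^ k) (P j)" for j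
  define S where "S = (\<Sum>j\<le>m. real_of_int (\<beta> j) * poly (T j) x)"
  have S0: "S \<noteq> 0" using k(2) by (simp add: S_def T_def)
  have T_Ints: "coeff (T j) N \<in> \<int>" for j N
    unfolding T_def
  proof (rule twisted_deriv_power_Ints)
    fix N
    show "coeff (P j) N \<in> \<int>"
    proof (cases "N \<le> n")
      case True
      then have "(fact n / fact N :: real) = of_nat (fact n div fact N)"
        by (simp add: fact_dvd real_of_nat_div)
      then have "coeff (P j) N = real_of_int (int (fact n div fact N) * (\<Sum>h\<le>n. int (N choose h) * a j ^ (N - h) * c h))"
        using True by (simp add: coeffP F_nth del: of_int_sum)
      then show ?thesis by (simp only: Ints_of_int)
    qed (simp add: coeffP)
  qed simp
  have degT: "degree (T j) \<le> n" for j
    using degree_coeff_twisted_deriv_power[OF degP] by (simp add: T_def)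
  have "real_of_int q ^ n * S = (\<Sum>j\<le>m. real_of_int (\<beta> j) * (real_of_int q ^ n * poly (T j) x))"
    by (simp add: S_def sum_distrib_left mult_ac)
  also have "\<dots> \<in> \<int>"
    unfolding x_def using q by (intro Ints_sum Ints_mult power_mult_poly_inverse_Ints T_Ints degT) auto
  finally have "1 \<le> \<bar>real_of_int q ^ n * S\<bar>"
    using S0 q by (intro Ints_nonzero_abs_ge1) auto
  also have "\<dots> = q ^ n * \<bar>S\<bar>" using q by (simp add: abs_mult)
  finally have one: "1 \<le> q ^ n * \<bar>S\<bar>" .
  define D where "D = (fact n * real C)"
  have D: "0 \<le> D" by (simp add: D_def)
  \<comment> \<open>Since \<open>a 0 = 0\<close>, the approximation with index 0 is derived by
    ordinary differentiation.\<close>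
  define B0 where "B0 = (pderiv ^^ k) A0"
  have B0_fps: "fps_of_poly B0 = (fps_twisted_deriv 0 ^^ k) (fps_of_poly A0)"
  proof -
    have "twisted_deriv (0 :: real) = pderiv" by (simp add: twisted_deriv_def fun_eq_iff)
    then show ?thesis using fps_of_poly_twisted_deriv_power[of k 0 A0] by (simp add: B0_def)
  qed
  have B0_bound: "\<bar>poly B0 x\<bar> \<le> D * exp 1"
  proof -
    have A0b: "\<bar>fps_nth (fps_of_poly A0) N\<bar> \<le> D * 1 ^ N / fact N" for N
      using F_bound[of 0 N] by (simp add: F_def a0 D_def)
    have b: "\<bar>coeff B0 N\<bar> \<le> D / fact N" for N
      using fps_nth_twisted_deriv_power_bound[OF A0b, where a = 0 and k = k and N = N]
      by (simp flip: B0_fps)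
    have "\<bar>poly B0 x\<bar> \<le> D * x ^ 0 / fact 0 * exp x"
    proof (rule exp_tail_bound[OF poly_sums])
      show "\<bar>coeff B0 N * x ^ N\<bar> \<le> D * x ^ N / fact N" for N
        using mult_right_mono[OF b[of N], of "x ^ N"] x by (simp add: abs_mult)
    qed (use D x in auto)
    also have "\<dots> \<le> D * exp 1" using D x by (simp add: mult_left_mono)
    finally show ?thesis .
  qed
  define E where "E j = D * (1 + 2 * \<bar>real_of_int (a j)\<bar>) ^ k
          * ((1 + \<bar>real_of_int (a j)\<bar>) / q) ^ (n + l j + 1 - k) / fact (n + l j + 1 - k)
          * exp ((1 + \<bar>real_of_int (a j)\<bar>) / q)" for j
  have approx: "\<bar>poly (T j) x - exp (a j * x) * poly B0 x\<bar> \<le> E j" if "1 \<le> j" "j \<le> m" for j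
  proof -
    define G where "G = (fps_twisted_deriv (real_of_int (a j)) ^^ k) (R j)"
    have G: "G = fps_of_poly (T j) - fps_exp (real_of_int (a j)) * fps_of_poly B0"
      by (simp add: G_def R_def F_def fps_twisted_deriv_power_diff fps_of_poly_twisted_deriv_power T_def
          fps_twisted_deriv_power_exp_mult B0_fps)
    have Rb: "\<bar>fps_nth (R j) N\<bar> \<le> D * (1 + \<bar>real_of_int (a j)\<bar>) ^ N / fact N" for N
      using F_bound[of j N] D by (auto simp: R_nth D_def)
    have Gb: "\<bar>fps_nth G N\<bar> \<le> D * (1 + 2 * \<bar>real_of_int (a j)\<bar>) ^ k * (1 + \<bar>real_of_int (a j)\<bar>) ^ N / fact N" for N
      using fps_nth_twisted_deriv_power_bound[OF Rb, where a = "real_of_int (a j)" and k = k and N = N] by (simp add: G_def add.assoc)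
    have sG: "(\<lambda>N. fps_nth G N * x ^ N) sums (poly (T j) x - exp (a j * x) * poly B0 x)"
      using sums_diff[OF poly_sums[of "T j" x] fps_exp_mult_poly_sums[of "real_of_int (a j)" B0 x]]
      by (simp add: G left_diff_distrib)
    have "\<bar>poly (T j) x - exp (a j * x) * poly B0 x\<bar> \<le> D * (1 + 2 * \<bar>real_of_int (a j)\<bar>) ^ k
          * ((1 + \<bar>real_of_int (a j)\<bar>) / q) ^ (n + l j + 1 - k) / fact (n + l j + 1 - k)
          * exp ((1 + \<bar>real_of_int (a j)\<bar>) / q)"
    proof (rule exp_tail_bound[OF sG])
      have "fps_X ^ (n + l j + 1 - k) dvd G"
        unfolding G_def by (rule fps_X_power_dvd_fps_twisted_deriv[OF R_ord[OF that]])
      then show "fps_nth G N * x ^ N = 0" if "N < n + l j + 1 - k" for N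
        using that by (simp add: fps_X_power_dvd_iff)
      show "\<bar>fps_nth G N * x ^ N\<bar> \<le> D * (1 + 2 * \<bar>real_of_int (a j)\<bar>) ^ k
          * ((1 + \<bar>real_of_int (a j)\<bar>) / q) ^ N / fact N" for N
        using mult_right_mono[OF Gb[of N], of "x ^ N"] x
        by (simp add: abs_mult x_def power_divide mult.commute)
    qed (use D q in auto)
    then show ?thesis by (simp add: E_def)
  qed
  define L where "L = (\<Sum>j\<le>m. \<beta> j * exp (a j / q))"
  have split: "{..m} = insert 0 {1..m}" by auto
  have T0: "T 0 = B0"
  proof -
    have "twisted_deriv (0 :: real) = pderiv" by (simp add: twisted_deriv_def fun_eq_iff)
    then show ?thesis by (simp add: T_def B0_def a0 P0)
  qed
  \<comment> \<open>Each \<open>T j\<close> is compared with the exponential times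
    \<open>B0\<close>; the summand with index 0 disappears because \<open>T 0 = B0\<close>.\<close>
  have "S - poly B0 x * L = (\<Sum>j\<le>m. real_of_int (\<beta> j) * (poly (T j) x - exp (a j * x) * poly B0 x))"
    unfolding S_def L_def sum_distrib_left sum_subtractf[symmetric]
    by (intro sum.cong refl) (simp add: x_def right_diff_distrib mult_ac)
  also have "\<dots> = (\<Sum>j=1..m. real_of_int (\<beta> j) * (poly (T j) x - exp (a j * x) * poly B0 x))"
    unfolding split by (simp add: T0 a0)
  finally have SL: "S - poly B0 x * L = (\<Sum>j=1..m. real_of_int (\<beta> j) * (poly (T j) x - exp (a j * x) * poly B0 x))" .
  have "\<bar>S - poly B0 x * L\<bar> \<le> (\<Sum>j=1..m. \<bar>real_of_int (\<beta> j) * (poly (T j) x - exp (a j * x) * poly B0 x)\<bar>)"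
    unfolding SL by (rule sum_abs)
  also have "\<dots> \<le> (\<Sum>j=1..m. \<bar>real_of_int (\<beta> j)\<bar> * E j)"
    unfolding abs_mult using approx by (intro sum_mono mult_left_mono) auto
  finally have 1: "\<bar>S - poly B0 x * L\<bar> \<le> (\<Sum>j=1..m. \<bar>real_of_int (\<beta> j)\<bar> * E j)" .
  have 2: "\<bar>poly B0 x * L\<bar> \<le> D * exp 1 * \<bar>L\<bar>"
    unfolding abs_mult by (intro mult_right_mono B0_bound) simp
  have "\<bar>S\<bar> \<le> D * exp 1 * \<bar>L\<bar> + (\<Sum>j=1..m. \<bar>real_of_int (\<beta> j)\<bar> * E j)"
    using 1 2 by linarith
  then have "q ^ n * \<bar>S\<bar> \<le> q ^ n * (D * exp 1 * \<bar>L\<bar> + (\<Sum>j=1..m. \<bar>real_of_int (\<beta> j)\<bar> * E j))"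
    using q by (intro mult_left_mono) auto
  with one have "1 \<le> q ^ n * (D * exp 1 * \<bar>L\<bar>) + q ^ n * (\<Sum>j=1..m. \<bar>real_of_int (\<beta> j)\<bar> * E j)"
    unfolding distrib_left by linarith
  moreover have "k + (\<Sum>j=1..m. l j) \<le> n + m ^ 2"
    using k(1) M by (simp add: K_def M'_def)
  ultimately show thesis
    by (intro that[of k]) (simp_all only: D_def E_def L_def)
qed

section \<open>Bounds for the linear form in terms of orders and parameters\<close>

text \<open>This says n!/(n+s-k)! is at most n^(k-s), written without division so that it covers
  both signs of \<open>k - s\<close>.\<close>

lemma fact_mult_power_le:
  assumes "k \<le> n"
  shows "fact n * n ^ s \<le> (fact (n + s - k) * n ^ k :: nat)"
proof (cases "k \<le> s")
  case True
  have 1: "fact n * n ^ i \<le> (fact (n + i) :: nat)" for i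
  proof (induction i)
    case (Suc i)
    have "fact n * n ^ Suc i = n * (fact n * n ^ i)" by simp
    also have "\<dots> \<le> (n + i + 1) * (fact n * n ^ i)" by (rule mult_right_mono) auto
    also have "\<dots> \<le> (n + i + 1) * fact (n + i)" by (rule mult_left_mono[OF Suc]) simp
    finally show ?case by simp
  qed simp
  have "fact n * n ^ s = (fact n * n ^ (s - k)) * n ^ k"
    using True by (simp flip: power_add)
  also have "\<dots> \<le> fact (n + (s - k)) * n ^ k" by (rule mult_right_mono[OF 1]) simp
  finally show ?thesis using True by simp
next
  case False
  have 1: "fact n \<le> (fact (n - i) * n ^ i :: nat)" if "i \<le> n" for i
    using that
  proof (induction i)
    case (Suc i)
    have "fact n \<le> (fact (n - i) * n ^ i :: nat)" using Suc by simp
    also have "fact (n - i) = (n - i) * (fact (n - Suc i) :: nat)"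
      using Suc.prems by (metis Suc_diff_Suc Suc_le_lessD fact_Suc of_nat_id)
    also have "(n - i) * fact (n - Suc i) * n ^ i \<le> n * fact (n - Suc i) * n ^ i"
      by (intro mult_right_mono) auto
    finally show ?case by (simp add: mult_ac)
  qed simp
  have "fact n * n ^ s \<le> (fact (n - (k - s)) * n ^ (k - s)) * n ^ s"
    using assms by (intro mult_right_mono 1) auto
  also have "\<dots> = fact (n - (k - s)) * n ^ k"
    using False by (simp flip: power_add)
  finally show ?thesis using False assms by simp
qed

text \<open>The condition on the \<open>\<beta> j\<close> makes each remainder at most 1/n, and
  \<open>2 * m \<le> n\<close> leaves at least 1/2 for the linear form. The constant 6 combines this
  factor 2 with \<open>exp 1 \<le> 3\<close>.\<close>

lemma linear_form_bound_of_orders: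
  fixes a \<beta> :: "nat \<Rightarrow> int" and l :: "nat \<Rightarrow> nat" and q :: int and Q :: real
  assumes inj: "inj_on a {..m}" and a0: "a 0 = 0" and q: "q > 0" "q \<le> Q"
    and Q: "\<And>j. 1 \<le> j \<Longrightarrow> j \<le> m \<Longrightarrow> 1 + real_of_int \<bar>a j\<bar> \<le> Q" "2 \<le> Q" "Q \<le> n * ln Q"
    and M: "(\<Sum>j=1..m. l j) \<le> n" and m: "2 * m \<le> n" "1 \<le> m"
    and K: "n + m ^ 2 \<le> K + (\<Sum>j=1..m. l j)" "K \<le> n"
    and C: "Q ^ (2 * n * (\<Sum>j=1..m. l j)) < (real C + 1) ^ (n + 1 - (\<Sum>j=1..m. l j))"
    and \<beta>: "j0 \<le> m" "\<beta> j0 \<noteq> 0"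
    and H: "\<And>j. 1 \<le> j \<Longrightarrow> j \<le> m \<Longrightarrow> \<bar>real_of_int (\<beta> j)\<bar> * C * Q ^ (7 * n) * real n ^ K \<le> real n ^ l j"
  shows "1 \<le> 6 * Q ^ n * real n ^ n * C * \<bar>\<Sum>j\<le>m. \<beta> j * exp (a j / q)\<bar>"
proof -
  have l: "l j \<le> n" if "1 \<le> j" "j \<le> m" for j
    using member_le_sum[of j "{1..m}" l] that M by simp
  have Q1: "1 \<le> Q" using Q by simp
  have mn: "m \<le> n" using m by simp
  define \<Lambda> where "\<Lambda> = (\<Sum>j\<le>m. \<beta> j * exp (a j / q))"
  obtain k where k: "k + (\<Sum>j=1..m. l j) \<le> n + m ^ 2" and
    one: "1 \<le> q ^ n * (fact n * real C * exp 1 * \<bar>\<Lambda>\<bar>)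
      + q ^ n * (\<Sum>j=1..m. \<bar>real_of_int (\<beta> j)\<bar> * (fact n * real C * (1 + 2 * \<bar>real_of_int (a j)\<bar>) ^ k
          * ((1 + \<bar>real_of_int (a j)\<bar>) / q) ^ (n + l j + 1 - k) / fact (n + l j + 1 - k)
          * exp ((1 + \<bar>real_of_int (a j)\<bar>) / q)))"
    unfolding \<Lambda>_def
    by (rule exists_nonvanishing_approximation[of a m q Q l n C j0 \<beta>, OF inj a0 q(1) Q(1) Q1 l M mn C \<beta>])
  have kK: "k \<le> K" using k K(1) by linarith
  have n0: "0 < n" using m by simp
  have summand: "q ^ n * (\<bar>real_of_int (\<beta> j)\<bar> * (fact n * real C * (1 + 2 * \<bar>real_of_int (a j)\<bar>) ^ k
          * ((1 + \<bar>real_of_int (a j)\<bar>) / q) ^ (n + l j + 1 - k) / fact (n + l j + 1 - k)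
          * exp ((1 + \<bar>real_of_int (a j)\<bar>) / q))) \<le> 1 / n" if j: "1 \<le> j" "j \<le> m" for j
  proof -
    define b where "b = 1 + \<bar>real_of_int (a j)\<bar>"
    define N0 where "N0 = n + l j + 1 - k"
    have b: "0 < b" "b \<le> Q" using Q(1)[OF j] by (auto simp: b_def)
    have bq: "b / q \<le> Q"
    proof -
      have "b / q \<le> b / 1" using q(1) b by (intro divide_left_mono) auto
      with b show ?thesis by simp
    qed
    have bq0: "0 \<le> b / q" using b q by simp
    have 1: "(1 + 2 * \<bar>real_of_int (a j)\<bar>) ^ k \<le> Q ^ (2 * n)"
    proof -
      have "1 + 2 * \<bar>real_of_int (a j)\<bar> \<le> 2 * Q" using b by (simp add: b_def)
      also have "\<dots> \<le> Q ^ 2" using mult_right_mono[OF Q(2), of Q] Q1 by (simp add: power2_eq_square)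
      finally have "(1 + 2 * \<bar>real_of_int (a j)\<bar>) ^ k \<le> (Q ^ 2) ^ k" by (intro power_mono) auto
      also have "\<dots> \<le> Q ^ (2 * n)" unfolding power_mult[symmetric]
        using kK K(2) by (intro power_increasing Q1) auto
      finally show ?thesis .
    qed
    have 2: "(b / q) ^ N0 \<le> Q ^ (3 * n)"
    proof -
      have "(b / q) ^ N0 \<le> Q ^ N0" by (intro power_mono bq bq0)
      also have "\<dots> \<le> Q ^ (3 * n)" using l[OF j] n0 by (intro power_increasing Q1) (auto simp: N0_def)
      finally show ?thesis .
    qed
    have 3: "exp (b / q) \<le> Q ^ n"
    proof -
      have "exp (b / q) \<le> exp (n * ln Q)" using bq Q(3) by simp
      also have "\<dots> = Q ^ n" using Q1 by (simp add: exp_of_nat_mult)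
      finally show ?thesis .
    qed
    have 4: "real_of_int q ^ n \<le> Q ^ n" using q by (intro power_mono) auto
    \<comment> \<open>The order of vanishing is \<open>n + l j + 1\<close>; its last unit supplies
      the factor 1/n.\<close>
    have "fact n * n ^ (l j + 1) \<le> (fact (n + (l j + 1) - k) * n ^ k :: nat)"
      using kK K(2) by (intro fact_mult_power_le) simp
    then have "real (fact n * n ^ (l j + 1)) \<le> real (fact (n + (l j + 1) - k) * n ^ k)"
      by (rule of_nat_mono)
    then have "fact n * real n ^ (l j + 1) \<le> fact N0 * real n ^ k" by (simp add: N0_def del: fact_Suc)
    also have "\<dots> \<le> fact N0 * real n ^ K"
      using kK n0 by (intro mult_left_mono power_increasing) auto
    finally have 5: "fact n / fact N0 \<le> real n ^ K / real n ^ (l j + 1)"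
      using n0 by (simp add: divide_simps mult_ac del: fact_Suc)
    have "q ^ n * (\<bar>real_of_int (\<beta> j)\<bar> * (fact n * real C * (1 + 2 * \<bar>real_of_int (a j)\<bar>) ^ k
          * (b / q) ^ N0 / fact N0 * exp (b / q)))
      = (\<bar>real_of_int (\<beta> j)\<bar> * C) * (real_of_int q ^ n * ((1 + 2 * \<bar>real_of_int (a j)\<bar>) ^ k * ((b / q) ^ N0 * (exp (b / q) * (fact n / fact N0)))))"
      by (simp add: mult_ac)
    also have "\<dots> \<le> (\<bar>real_of_int (\<beta> j)\<bar> * C) * (Q ^ n * (Q ^ (2 * n) * (Q ^ (3 * n) * (Q ^ n * (real n ^ K / real n ^ (l j + 1))))))"
      using q b Q1 bq0 n0 by (intro mult_mono mult_left_mono 1 2 3 4 5 mult_nonneg_nonneg zero_le_power) auto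
    \<comment> \<open>The exponent \<open>7 * n\<close> is the sum of \<open>n\<close>,
      \<open>2 * n\<close>, \<open>3 * n\<close> and \<open>n\<close> from the denominators, the
      derivatives, the power of \<open>b / q\<close> and the exponential.\<close>
    also have "\<dots> = (\<bar>real_of_int (\<beta> j)\<bar> * C * Q ^ (7 * n) * real n ^ K) / real n ^ (l j + 1)"
    proof -
      have "Q ^ (7 * n) = Q ^ n * (Q ^ (2 * n) * (Q ^ (3 * n) * Q ^ n))" by (simp flip: power_add)
      then show ?thesis by (simp add: mult_ac)
    qed
    also have "\<dots> \<le> real n ^ l j / real n ^ (l j + 1)"
      using H[OF j] by (intro divide_right_mono) auto
    also have "\<dots> = 1 / n" using n0 by simp
    finally show ?thesis by (simp add: b_def N0_def del: fact_Suc)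
  qed
  have "q ^ n * (\<Sum>j=1..m. \<bar>real_of_int (\<beta> j)\<bar> * (fact n * real C * (1 + 2 * \<bar>real_of_int (a j)\<bar>) ^ k
          * ((1 + \<bar>real_of_int (a j)\<bar>) / q) ^ (n + l j + 1 - k) / fact (n + l j + 1 - k)
          * exp ((1 + \<bar>real_of_int (a j)\<bar>) / q))) \<le> (\<Sum>j=1..m. 1 / n)"
    unfolding sum_distrib_left using summand by (intro sum_mono) auto
  also have "\<dots> \<le> 1 / 2" using m n0 by (simp add: divide_simps)
  finally have "1 / 2 \<le> q ^ n * (fact n * real C * exp 1 * \<bar>\<Lambda>\<bar>)" using one by linarith
  also have "\<dots> \<le> Q ^ n * (real n ^ n * C * 3 * \<bar>\<Lambda>\<bar>)"
  proof -
    have f: "fact n \<le> real n ^ n" using fact_le_power[of n, where 'a = real] by simp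
    have e: "exp 1 \<le> (3 :: real)" by (rule exp_le)
    have "fact n * real C * exp 1 \<le> real n ^ n * real C * 3" by (intro mult_mono f e) auto
    then have "fact n * real C * exp 1 * \<bar>\<Lambda>\<bar> \<le> real n ^ n * real C * 3 * \<bar>\<Lambda>\<bar>" by (rule mult_right_mono) simp
    moreover have "real_of_int q ^ n \<le> Q ^ n" using q by (intro power_mono) auto
    ultimately show ?thesis using Q1 by - (rule mult_mono, auto)
  qed
  finally show ?thesis by (simp add: \<Lambda>_def)
qed

text \<open>The surplus goes to index 1. An exact sum makes the defect in Siegel's lemma exactly the
  prescribed \<open>\<nu>\<close>.\<close>

lemma exists_with_sum_ge:
  fixes b :: "nat \<Rightarrow> nat"
  assumes "1 \<le> m" and "(\<Sum>j=1..m. b j) \<le> M"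
  shows "\<exists>l. (\<forall>j. b j \<le> l j) \<and> (\<Sum>j=1..m. l j) = M"
proof (intro exI conjI allI)
  show "(\<Sum>j=1..m. b j + (if j = 1 then M - (\<Sum>j=1..m. b j) else 0)) = M"
    using assms by (simp add: sum.distrib)
qed simp

text \<open>Each \<open>l j\<close> is the least order that beats \<open>H j\<close>, rounded up,
  with any surplus added. In the sum over \<open>j\<close> the \<open>H j\<close> enter only through
  the logarithm of their product, and the assumption on \<open>Y\<close> says that the total fits
  into \<open>n + 1 - \<nu>\<close>.\<close>

lemma linear_form_bound_of_parameters:
  fixes a \<beta> :: "nat \<Rightarrow> int" and H :: "nat \<Rightarrow> real" and m :: nat and q :: int and Q :: real
  defines "Y \<equiv> ln (\<Prod>j=1..m. H j)"
  assumes inj: "inj_on a {..m}" and a0: "a 0 = 0" and q: "q > 0" "q \<le> Q"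
    and Q: "\<And>j. 1 \<le> j \<Longrightarrow> j \<le> m \<Longrightarrow> 1 + real_of_int \<bar>a j\<bar> \<le> Q" "2 \<le> Q" "Q \<le> n * ln Q"
    and m: "2 * m \<le> n" "1 \<le> m" and \<nu>: "1 \<le> \<nu>" "\<nu> + m ^ 2 \<le> n"
    and \<beta>: "j0 \<le> m" "\<beta> j0 \<noteq> 0"
    and H: "\<And>j. 1 \<le> j \<Longrightarrow> j \<le> m \<Longrightarrow> max 1 \<bar>real_of_int (\<beta> j)\<bar> \<le> H j"
    and Y: "Y + m * (2 * ln Q * n ^ 2 / \<nu> + 7 * n * ln Q) + (m * (\<nu> + m ^ 2) + m + \<nu>) * ln n \<le> (n + 1) * ln n"
  shows "1 \<le> 6 * Q ^ n * real n ^ n * exp (2 * ln Q * n ^ 2 / \<nu>) * \<bar>\<Sum>j\<le>m. \<beta> j * exp (a j / q)\<bar>"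
proof -
  define E where "E = 2 * ln Q * n ^ 2 / \<nu>"
  define C where "C = nat \<lfloor>exp E\<rfloor>"
  have C: "real C \<le> exp E" "exp E < real C + 1" by (auto simp: C_def)
  have C1: "1 \<le> real C"
  proof -
    have "0 \<le> E" using Q by (simp add: E_def)
    then have "1 \<le> \<lfloor>exp E\<rfloor>" by (simp add: le_floor_iff)
    then show ?thesis by (simp add: C_def)
  qed
  have n2: "2 \<le> n" using m by simp
  have lnn: "0 < ln (real n)" using n2 by simp
  have Hpos: "1 \<le> H j" "\<bar>real_of_int (\<beta> j)\<bar> \<le> H j" if "1 \<le> j" "j \<le> m" for j
    using H[OF that] by auto
  have lnH: "Y = (\<Sum>j=1..m. ln (H j))"
    unfolding Y_def by (rule ln_prod) (use Hpos in \<open>force+\<close>)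
  \<comment> \<open>With the orders summing to \<open>n + 1 - \<nu>\<close>, fewer than
    \<open>\<nu> + m ^ 2\<close> derivatives are needed.\<close>
  define K where "K = \<nu> + m ^ 2"
  define X where "X j = (ln (H j) + E + 7 * n * ln Q) / ln n + K" for j
  define b where "b j = nat \<lceil>X j\<rceil>" for j
  have X0: "0 \<le> X j" if "1 \<le> j" "j \<le> m" for j
    using Hpos[OF that] Q lnn by (auto simp: X_def E_def intro!: add_nonneg_nonneg divide_nonneg_nonneg)
  \<comment> \<open>Rounding up costs at most 1 for each index, hence the isolated \<open>m\<close>
    in the assumption on \<open>Y\<close>.\<close>
  have "real (\<Sum>j=1..m. b j) \<le> (\<Sum>j=1..m. X j + 1)"
    unfolding of_nat_sum using X0 by (intro sum_mono) (auto simp: b_def)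
  also have "\<dots> = (Y + m * (E + 7 * n * ln Q)) / ln n + m * K + m"
    by (simp add: X_def lnH sum.distrib add_divide_distrib sum_divide_distrib distrib_left)
  also have "\<dots> \<le> n + 1 - real \<nu>"
  proof -
    have "(Y + m * (E + 7 * n * ln Q)) / ln n \<le> n + 1 - real \<nu> - m * K - m"
      unfolding divide_le_eq using Y lnn by (simp add: E_def K_def algebra_simps)
    then show ?thesis by linarith
  qed
  also have "\<dots> = real (n + 1 - \<nu>)" using \<nu> by (simp add: of_nat_diff)
  finally have "(\<Sum>j=1..m. b j) \<le> n + 1 - \<nu>" by (simp only: of_nat_le_iff)
  from exists_with_sum_ge[OF m(2) this]
  obtain l where l: "\<forall>j. b j \<le> l j" "(\<Sum>j=1..m. l j) = n + 1 - \<nu>" by (elim exE conjE)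
  have "1 \<le> 6 * Q ^ n * real n ^ n * C * \<bar>\<Sum>j\<le>m. \<beta> j * exp (a j / q)\<bar>"
  proof (rule linear_form_bound_of_orders[of a m q Q n l K C j0 \<beta>])
    show "(\<Sum>j=1..m. l j) \<le> n" "n + m ^ 2 \<le> K + (\<Sum>j=1..m. l j)" "K \<le> n"
      using l(2) \<nu> by (auto simp: K_def)
    show "Q ^ (2 * n * (\<Sum>j=1..m. l j)) < (real C + 1) ^ (n + 1 - (\<Sum>j=1..m. l j))"
    proof -
      \<comment> \<open>\<open>E\<close> is such that the \<open>\<nu>\<close>-th power of
        \<open>exp E\<close> is \<open>Q ^ (2 * n * n)\<close>, and \<open>C + 1\<close> exceeds
        \<open>exp E\<close>.\<close>
      have "Q ^ (2 * n * (\<Sum>j=1..m. l j)) \<le> Q ^ (2 * n * n)"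
        using l(2) \<nu> Q by (intro power_increasing) auto
      also have "\<dots> = exp (real (2 * n * n) * ln Q)"
        by (subst exp_of_nat_mult) (use Q in simp)
      also have "real (2 * n * n) * ln Q = \<nu> * E"
        using \<nu> by (simp add: E_def power2_eq_square)
      also have "exp (\<nu> * E) = exp E ^ \<nu>" by (simp add: exp_of_nat_mult)
      also have "\<dots> < (real C + 1) ^ \<nu>" using C \<nu> by (intro power_strict_mono) auto
      also have "\<nu> = n + 1 - (\<Sum>j=1..m. l j)" using l(2) \<nu> by simp
      finally show ?thesis .
    qed
    show "\<bar>real_of_int (\<beta> j)\<bar> * C * Q ^ (7 * n) * real n ^ K \<le> real n ^ l j" if j: "1 \<le> j" "j \<le> m" for j
    proof -
      have "X j \<le> real (b j)" unfolding b_def by (rule of_nat_ceiling)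
      also have "\<dots> \<le> real (l j)" using l(1) by simp
      finally have "(ln (H j) + E + 7 * n * ln Q) / ln n \<le> real (l j) - K" by (simp add: X_def)
      then have "ln (H j) + E + 7 * n * ln Q + K * ln n \<le> l j * ln n"
        unfolding pos_divide_le_eq[OF lnn] left_diff_distrib by linarith
      then have "exp (ln (H j) + E + real (7 * n) * ln Q + K * ln n) \<le> exp (l j * ln n)" by simp
      then have "exp (ln (H j)) * exp E * exp (ln Q) ^ (7 * n) * exp (ln n) ^ K \<le> exp (ln n) ^ l j"
        by (simp only: exp_add exp_of_nat_mult)
      then have le: "H j * exp E * Q ^ (7 * n) * real n ^ K \<le> real n ^ l j"
        using Hpos[OF j] Q n2 by simp
      have "\<bar>real_of_int (\<beta> j)\<bar> * C * Q ^ (7 * n) * real n ^ K \<le> H j * exp E * Q ^ (7 * n) * real n ^ K"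
        using Hpos[OF j] C Q by (intro mult_mono) auto
      with le show ?thesis by linarith
    qed
  qed (use inj a0 q Q m \<beta> in blast)+
  also have "\<dots> \<le> 6 * Q ^ n * real n ^ n * exp E * \<bar>\<Sum>j\<le>m. \<beta> j * exp (a j / q)\<bar>"
    using C Q by (intro mult_right_mono mult_left_mono) auto
  finally show ?thesis by (simp add: E_def)
qed

section \<open>Choice of the parameters\<close>

text \<open>
  With \<open>y = ln Y\<close> and \<open>d = sqrt (\<kappa> / y)\<close> the choice is \<open>n \<approx> (1 + 7 m d) Y / (y - ln y)\<close> and
  \<open>\<nu> \<approx> 3/2 d n\<close>.  The threshold on \<open>Y\<close> enters through \<open>m d \<le> 1 / sqrt 111\<close>, and \<open>y - ln y\<close> is
  used because it is a lower bound for \<open>ln n\<close> that is sharp up to \<open>1\<close>.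
\<close>

lemma parameter_choice:
  fixes m :: nat and \<kappa> Y :: real
  assumes m: "2 \<le> m" and \<kappa>: "2 / 3 \<le> \<kappa>"
    and Y: "56 * real m ^ 2 * \<kappa> * exp (111 * real m ^ 2 * \<kappa>) \<le> Y"
  obtains n \<nu> :: nat where "exp \<kappa> \<le> n * \<kappa>" "2 * m \<le> n" "1 \<le> \<nu>" "\<nu> + m ^ 2 \<le> n"
    "Y + m * (2 * \<kappa> * n ^ 2 / \<nu> + 7 * n * \<kappa>) + (m * (\<nu> + m ^ 2) + m + \<nu>) * ln n \<le> (n + 1) * ln n"
    "ln 6 + n * \<kappa> + n * ln n + 2 * \<kappa> * n ^ 2 / \<nu>
      < Y + (sqrt m + (4 + sqrt m + 8 * m) * sqrt \<kappa>) * Y / sqrt (ln Y)"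
proof -
  define \<mu> where "\<mu> = real m"
  have \<mu>: "2 \<le> \<mu>" using m by (simp add: \<mu>_def)
  have \<mu>2: "4 \<le> \<mu>\<^sup>2" "2 * \<mu> \<le> \<mu>\<^sup>2" using mult_mono[OF \<mu> \<mu>] mult_right_mono[OF \<mu>, of \<mu>] \<mu>
    by (simp_all add: power2_eq_square)
  have \<mu>2\<kappa>: "8 / 3 \<le> \<mu>\<^sup>2 * \<kappa>" using mult_mono[OF \<mu>2(1) \<kappa>] by simp
  have Y0: "0 < Y" by (rule less_le_trans[OF _ Y]) (use m \<kappa> in simp)
  define y where "y = ln Y"
  have Yexp: "Y = exp y" using Y0 by (simp add: y_def)
  \<comment> \<open>The prefactor of the threshold is at least 56 * 8/3, which exceeds 149; this
    adds the 4 to the lower bound for \<open>y\<close>.\<close>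
  have exp4: "exp 4 \<le> (149 :: real)"
  proof -
    have "exp (4 :: real) = exp 1 ^ 4" by (simp flip: exp_of_nat_mult)
    also have "\<dots> \<le> 3 ^ 4" using exp_le by (intro power_mono) auto
    finally show ?thesis by simp
  qed
  have y_ge: "4 + 111 * (\<mu>\<^sup>2 * \<kappa>) \<le> y"
  proof -
    have "exp (4 + 111 * (\<mu>\<^sup>2 * \<kappa>)) = exp 4 * exp (111 * \<mu>\<^sup>2 * \<kappa>)" by (simp add: exp_add mult.assoc)
    also have "\<dots> \<le> (56 * \<mu>\<^sup>2 * \<kappa>) * exp (111 * \<mu>\<^sup>2 * \<kappa>)"
      using exp4 \<mu>2\<kappa> by (intro mult_right_mono) auto
    also have "\<dots> \<le> exp y" using Y by (simp add: \<mu>_def Yexp)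
    finally show ?thesis by simp
  qed
  have y300: "300 \<le> y" and y111: "111 * (\<mu>\<^sup>2 * \<kappa>) \<le> y" using y_ge \<mu>2\<kappa> by auto
  have \<mu>2y: "74 * \<mu>\<^sup>2 \<le> y" using y111 mult_left_mono[OF \<kappa>, of "\<mu>\<^sup>2"] by simp
  have \<kappa>y: "444 * \<kappa> \<le> y" 
  proof -
    have "4 * \<kappa> \<le> \<mu>\<^sup>2 * \<kappa>" using \<mu>2(1) \<kappa> by (intro mult_right_mono) auto
    with y111 show ?thesis by linarith
  qed
  \<comment> \<open>All losses below are measured by \<open>d\<close> and \<open>u\<close>. The
    threshold gives \<open>u\<^sup>2 \<le> 1 / 111\<close>, and 0.095 lies just above the square
    root of 1/111.\<close>
  define d where "d = sqrt (\<kappa> / y)"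
  define u where "u = \<mu> * d"
  have d0: "0 < d" using \<kappa> y300 by (simp add: d_def)
  have d2: "\<kappa> = d\<^sup>2 * y" using \<kappa> y300 by (simp add: d_def)
  have u0: "0 < u" using d0 \<mu> by (simp add: u_def)
  have u2: "u\<^sup>2 * y = \<mu>\<^sup>2 * \<kappa>" by (simp add: u_def d2 power_mult_distrib)
  have u_le: "u \<le> 95 / 1000"
  proof (rule power2_le_imp_le)
    have "u\<^sup>2 * y \<le> (1 / 111) * y" using y111 u2 by simp
    then have "u\<^sup>2 \<le> 1 / 111" using y300 by (simp only: mult_le_cancel_right_pos)
    also have "1 / 111 \<le> (95 / 1000 :: real)\<^sup>2" by (simp add: power2_eq_square)
    finally show "u\<^sup>2 \<le> (95 / 1000)\<^sup>2" .
  qed simp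
  have d_le: "2 * d \<le> u" using mult_right_mono[OF \<mu>, of d] d0 by (simp add: u_def)
  have u_ge: "1 \<le> u * y"
  proof (rule power2_le_imp_le)
    have "1 * 1 \<le> (\<mu>\<^sup>2 * \<kappa>) * y" using \<mu>2\<kappa> y300 by (intro mult_mono) auto
    also have "(\<mu>\<^sup>2 * \<kappa>) * y = (u * y)\<^sup>2" unfolding u2[symmetric] by (simp add: power2_eq_square)
    finally show "1\<^sup>2 \<le> (u * y)\<^sup>2" by simp
  qed (use u0 y300 in simp)
  define w where "w = y - ln y"
  \<comment> \<open>The tangent of the logarithm at 300 together with \<open>ln 300 \<le> 6\<close>
    suffices. It makes \<open>y / w\<close> at most 50/49, rounded up to 1.021.\<close>
  have lny: "ln y \<le> y / 50"
  proof -
    have "exp (1 / 2 :: real) \<ge> 13 / 8" using exp_lower_Taylor_quadratic[of "1 / 2"] by (simp add: power2_eq_square)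
    then have "(13 / 8 :: real) ^ 12 \<le> exp (1 / 2) ^ 12" by (intro power_mono) auto
    also have "\<dots> = exp 6" by (simp flip: exp_of_nat_mult)
    finally have "(13 / 8) ^ 12 \<le> exp (6 :: real)" .
    moreover have "300 \<le> (13 / 8 :: real) ^ 12" by (simp add: power_divide)
    ultimately have "300 \<le> exp (6 :: real)" by linarith
    then have "ln 300 \<le> ln (exp (6 :: real))" by (intro ln_mono) auto
    then have "ln 300 \<le> (6 :: real)" by simp
    moreover have "ln (y / 300) \<le> y / 300 - 1" using y300 by (intro ln_le_minus_one) simp
    moreover have "ln (y / 300) = ln y - ln 300" using y300 by (simp add: ln_div)
    ultimately show ?thesis using y300 by simp
  qed
  have w_le: "w \<le> y" using y300 by (simp add: w_def)
  have yw: "y \<le> 1021 / 1000 * w" using lny y300 by (simp add: w_def)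
  have w0: "0 < w" and w293: "293 \<le> w" using yw y300 by auto
  define W where "W = exp w"
  have YW: "Y = y * W"
    using y300 by (simp add: W_def w_def Yexp exp_diff)
  \<comment> \<open>Comparing \<open>exp (w / 4)\<close> with \<open>w / 4\<close> and taking fourth
    powers gives this; it makes all polynomial terms in \<open>y\<close> negligible against
    \<open>W\<close>.\<close>
  have yW: "y ^ 3 \<le> W"
  proof -
    have "y ^ 3 \<le> (1021 / 1000 * w) ^ 3" using yw y300 by (intro power_mono) auto
    also have "\<dots> = (1021 / 1000) ^ 3 * w ^ 3" by (simp only: power_mult_distrib)
    also have "\<dots> \<le> (w / 256) * w ^ 3" using w293 by (intro mult_right_mono) (auto simp: power3_eq_cube)
    also have "\<dots> = (w / 4) ^ 4" by (simp add: power_divide eval_nat_numeral)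
    also have "\<dots> \<le> exp (w / 4) ^ 4"
    proof (rule power_mono)
      show "w / 4 \<le> exp (w / 4)" using exp_ge_add_one_self[of "w / 4"] by linarith
    qed (use w0 in simp)
    also have "\<dots> = W" by (simp add: W_def flip: exp_of_nat_mult)
    finally show ?thesis .
  qed
  have y2: "300 * y \<le> y\<^sup>2" using y300 by (simp add: power2_eq_square)
  have y3: "300 * y\<^sup>2 \<le> y ^ 3" using mult_right_mono[OF y300, of "y\<^sup>2"] by (simp add: power3_eq_cube power2_eq_square)
  have W0: "0 < W" by (simp add: W_def)
  \<comment> \<open>To leading order \<open>n * ln n\<close> has to reach \<open>Y\<close>, which
    \<open>Y / w\<close> achieves; the factor \<open>1 + 7 * u\<close> pays for the terms
    proportional to \<open>u * n * w\<close>.\<close>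
  define z where "z = (1 + 7 * u) * Y / w"
  define n where "n = nat \<lceil>z\<rceil>"
  have z0: "0 \<le> z" using u0 Y0 w0 by (simp add: z_def)
  have nz: "z \<le> n" "real n \<le> z + 1" using z0 by (auto simp: n_def)
  have zw: "z * w = (1 + 7 * u) * Y" using w0 by (simp add: z_def)
  have z_ge: "W \<le> z"
  proof -
    have "W * w \<le> W * y" using w_le W0 by simp
    also have "\<dots> = 1 * Y" by (simp add: YW)
    also have "\<dots> \<le> (1 + 7 * u) * Y" using u0 Y0 by (intro mult_right_mono) auto
    finally show ?thesis using w0 by (simp add: z_def pos_le_divide_eq)
  qed
  have z_le: "z \<le> 17 / 10 * W"
  proof -
    have "(1 + 7 * u) * Y = (1 + 7 * u) * (y * W)" by (simp add: YW)
    also have "\<dots> \<le> (1665 / 1000) * ((1021 / 1000 * w) * W)"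
      using u_le u0 yw y300 W0 by (intro mult_mono) auto
    also have "\<dots> \<le> 17 / 10 * W * w" using w0 W0 by simp
    finally show ?thesis using w0 by (simp add: z_def pos_divide_le_eq)
  qed
  have nW: "W \<le> n" using nz z_ge by linarith
  have W1: "90000 \<le> W" using yW y3 y2 y300 by linarith
  have n_le: "n \<le> 2 * W" using nz z_le W1 by linarith
  have n0: "0 < real n" using nW W0 by linarith
  define Ln where "Ln = ln (real n)"
  have Ln1: "w \<le> Ln" using ln_mono[OF nW W0] by (simp add: Ln_def W_def)
  have Ln2: "Ln \<le> w + 1"
  proof -
    have "real n \<le> exp 1 * W" using n_le exp_ge_add_one_self[of 1] W0
      by (intro order.trans[OF n_le] mult_right_mono) auto
    also have "\<dots> = exp (w + 1)" by (simp add: W_def exp_add)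
    finally have "ln (real n) \<le> ln (exp (w + 1))" using n0 by (intro ln_mono) auto
    then show ?thesis by (simp add: Ln_def)
  qed
  \<comment> \<open>A larger \<open>\<nu>\<close> lowers the height term \<open>B\<close> but
    enlarges the defect; with this choice both losses have relative size \<open>d\<close>, and
    summing them over the \<open>m\<close> indices gives relative size \<open>u\<close>.\<close>
  define \<nu> where "\<nu> = nat \<lceil>3 / 2 * d * n\<rceil>"
  have dn: "0 < 3 / 2 * d * n" using d0 n0 by simp
  have \<nu>: "3 / 2 * d * n \<le> \<nu>" "real \<nu> \<le> 3 / 2 * d * n + 1" using dn by (auto simp: \<nu>_def)
  have \<nu>0: "0 < real \<nu>" using dn \<nu> by linarith
  define B where "B = 2 * \<kappa> * n ^ 2 / \<nu>"
  have B: "B \<le> 4 / 3 * d * y * n"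
  proof -
    have "B \<le> 2 * \<kappa> * n ^ 2 / (3 / 2 * d * n)"
      unfolding B_def using \<nu> dn \<nu>0 \<kappa> by (intro divide_left_mono) auto
    also have "\<dots> = 4 / 3 * d * y * n"
      using d0 n0 by (simp add: d2 power2_eq_square field_simps)
    finally show ?thesis .
  qed
  \<comment> \<open>\<open>t\<close> collects what does not grow with \<open>n\<close>:
    \<open>\<mu> ^ 3 + \<mu>\<close> from the formula and \<open>\<mu> + 1\<close> from rounding
    \<open>\<nu>\<close>, less the 1 in \<open>n + 1\<close>.\<close>
  define t where "t = \<mu> ^ 3 + 2 * \<mu>"
  have t: "t \<le> y\<^sup>2 / 1000"
  proof -
    have 1: "\<mu> \<le> y / 74" "\<mu>\<^sup>2 \<le> y / 74" using \<mu>2y \<mu>2 \<mu> by linarith+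
    have "\<mu> ^ 3 = \<mu> * \<mu>\<^sup>2" by (simp add: power3_eq_cube power2_eq_square)
    also have "\<dots> \<le> (y / 74) * (y / 74)" using 1 \<mu> y300 by (intro mult_mono) auto
    also have "\<dots> = y\<^sup>2 / 5476" by (simp add: power2_eq_square)
    finally have "\<mu> ^ 3 \<le> y\<^sup>2 / 5476" .
    with 1 y2 y300 show ?thesis unfolding t_def by linarith
  qed
  have un: "d * n \<le> 475 / 10000 * n" using d_le u_le n0 by (intro mult_right_mono) auto
  show thesis
  proof (rule that[of n \<nu>])
    show "exp \<kappa> \<le> n * \<kappa>"
    proof -
      have "exp \<kappa> * 2 \<le> exp \<kappa> * exp 1" using exp_ge_add_one_self[of "1 :: real"] by simp
      also have "\<dots> = exp (\<kappa> + 1)" by (simp add: exp_add)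
      also have "\<dots> \<le> W" using \<kappa>y yw y300 w_le by (simp add: W_def)
      finally have "exp \<kappa> \<le> W * (2 / 3)" using W0 by simp
      also have "\<dots> \<le> n * \<kappa>" using nW \<kappa> W0 by (intro mult_mono) auto
      finally show ?thesis .
    qed
    have "2 * \<mu> \<le> n" using \<mu>2 \<mu>2y y2 y3 yW nW y300 by linarith
    then show "2 * m \<le> n" by (simp add: \<mu>_def)
    show "1 \<le> \<nu>" using \<nu>0 by simp
    have "\<nu> + \<mu>\<^sup>2 \<le> n" using \<nu>(2) un \<mu>2y y2 y3 yW nW y300 by linarith
    then have "real (\<nu> + m ^ 2) \<le> real n" by (simp add: \<mu>_def)
    then show "\<nu> + m ^ 2 \<le> n" by (simp only: of_nat_le_iff)
    have 1: "\<mu> * (B + 7 * n * \<kappa>) \<le> n * w * (1701 / 1000 * u)"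
    proof -
      have "\<mu> * (B + 7 * n * \<kappa>) \<le> \<mu> * (4 / 3 * d * y * n + 7 * n * (d\<^sup>2 * y))"
        using B \<mu> d2 by (intro mult_left_mono) auto
      also have "\<dots> = n * (y * (u * (4 / 3 + 7 * d)))"
        by (simp add: u_def power2_eq_square algebra_simps)
      also have "\<dots> \<le> n * ((1021 / 1000 * w) * (u * (1666 / 1000)))"
        using d_le u_le yw n0 y300 u0 d0 by (intro mult_mono mult_left_mono) auto
      also have "\<dots> \<le> n * w * (1701 / 1000 * u)"
        using n0 w0 u0 by (simp add: mult_ac)
      finally show ?thesis .
    qed
    \<comment> \<open>\<open>c\<close> is the coefficient of \<open>ln n\<close> once all such terms
      are on one side. Its sign is needed to replace \<open>w\<close> by the larger
      \<open>Ln\<close>.\<close>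
    define c where "c = n + 1 - (\<mu> * (\<nu> + \<mu>\<^sup>2) + \<mu> + \<nu>)"
    have c: "n * (1 - 225 / 100 * u) - t \<le> c"
    proof -
      have "(\<mu> + 1) * \<nu> \<le> (\<mu> + 1) * (3 / 2 * d * n + 1)" using \<nu>(2) \<mu> by (intro mult_left_mono) auto
      also have "\<dots> = (\<mu> + 1) * (3 / 2 * d * n) + (\<mu> + 1)" by (simp add: distrib_left)
      \<comment> \<open>Here \<open>\<mu> \<ge> 2\<close> enters, and 9/4 is the product of 3/2 with
        3/2.\<close>
      also have "(\<mu> + 1) * (3 / 2 * d * n) \<le> (3 / 2 * \<mu>) * (3 / 2 * d * n)"
        using \<mu> dn by (intro mult_right_mono) auto
      also have "\<dots> = 225 / 100 * (u * n)" by (simp add: u_def)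
      finally have "(\<mu> + 1) * \<nu> \<le> 225 / 100 * (u * n) + (\<mu> + 1)" by simp
      moreover have "c = n + 1 - ((\<mu> + 1) * \<nu> + \<mu> ^ 3 + \<mu>)"
        by (simp add: c_def power3_eq_cube power2_eq_square algebra_simps)
      moreover have "n * (1 - 225 / 100 * u) = n - 225 / 100 * (u * n)" by (simp add: algebra_simps)
      ultimately show ?thesis unfolding t_def by linarith
    qed
    have un': "u * n \<le> 95 / 1000 * n" using u_le n0 by (intro mult_right_mono) auto
    have c0: "0 \<le> c"
    proof -
      have "t \<le> n / 2" using t y2 y3 yW nW y300 by linarith
      moreover have "n / 2 \<le> n * (1 - 225 / 100 * u)" using un' by (simp add: algebra_simps)
      ultimately show ?thesis using c by linarith
    qed
    have wt: "w * t \<le> 4 / 10 * u * Y"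
    proof -
      have "w * t \<le> y * (y\<^sup>2 / 1000)" using w_le t w0 \<mu> y300 by (intro mult_mono) (auto simp: t_def)
      also have "\<dots> = y ^ 3 / 1000" by (simp add: power3_eq_cube power2_eq_square)
      also have "\<dots> \<le> 4 / 10 * (1 * W)" using yW W0 by simp
      also have "\<dots> \<le> 4 / 10 * ((u * y) * W)" using u_ge W0 by (intro mult_left_mono mult_right_mono) auto
      finally show ?thesis by (simp add: YW)
    qed
    have "Y + w * t \<le> (1 + 4 / 10 * u) * Y" using wt by (simp add: algebra_simps)
    \<comment> \<open>The losses 1.701 u and 2.25 u add up to 3.951 u; for \<open>u\<close> up to
      0.095 the factor \<open>1 + 7 * u\<close> outweighs them with 0.4 u to spare for
      \<open>t\<close>.\<close>
    also have "\<dots> \<le> ((1 + 7 * u) * (1 - 3951 / 1000 * u)) * Y"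
    proof (intro mult_right_mono)
      have "u * u \<le> 95 / 1000 * u" using u_le u0 by (intro mult_right_mono) auto
      moreover have "(1 + 7 * u) * (1 - 3951 / 1000 * u) = 1 + 3049 / 1000 * u - 27657 / 1000 * (u * u)"
        by (simp add: field_simps)
      ultimately show "1 + 4 / 10 * u \<le> (1 + 7 * u) * (1 - 3951 / 1000 * u)" using u0 by linarith
    qed (use Y0 in simp)
    also have "\<dots> = z * w * (1 - 3951 / 1000 * u)" by (simp add: zw)
    also have "\<dots> \<le> n * w * (1 - 3951 / 1000 * u)"
      using nz w0 u_le by (intro mult_right_mono) auto
    finally have 2: "Y + w * t \<le> n * w * (1 - 3951 / 1000 * u)" .
    have "Y + \<mu> * (B + 7 * n * \<kappa>) \<le> w * (n * (1 - 225 / 100 * u) - t)"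
      using 1 2 by (simp add: algebra_simps)
    also have "\<dots> \<le> w * c" using c w0 by (intro mult_left_mono) auto
    also have "\<dots> \<le> Ln * c" using Ln1 c0 by (rule mult_right_mono)
    finally have "Y + \<mu> * (B + 7 * n * \<kappa>) + (\<mu> * (\<nu> + \<mu>\<^sup>2) + \<mu> + \<nu>) * Ln \<le> (n + 1) * Ln"
      by (simp add: c_def algebra_simps)
    then show "Y + m * (2 * \<kappa> * n ^ 2 / \<nu> + 7 * n * \<kappa>) + (m * (\<nu> + m ^ 2) + m + \<nu>) * ln n \<le> (n + 1) * ln n"
      by (simp add: B_def \<mu>_def Ln_def)
    define s where "s = 1 / sqrt y"
    \<comment> \<open>\<open>g\<close> bounds the logarithmic cost per unit of \<open>n\<close>; the
      coefficient 1.411 covers (4/3 + 0.0475) * 1.021.\<close>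
    define g where "g = w + 1 + 1411 / 1000 * d * w"
    have s0: "0 < s" using y300 by (simp add: s_def)
    have sy: "17 \<le> s * y"
    proof -
      have "s * y = sqrt y" using y300 by (simp add: s_def real_div_sqrt)
      moreover have "17 \<le> sqrt y" using y300 by (intro real_le_rsqrt) simp
      ultimately show ?thesis by simp
    qed
    have d_s: "d = sqrt \<kappa> * s" by (simp add: d_def s_def real_sqrt_divide)
    have dd: "d * (d * y) \<le> 475 / 10000 * (d * y)" using d_le u_le d0 y300 by (intro mult_right_mono) auto
    have dy: "d * y \<le> d * (1021 / 1000 * w)" using yw d0 by (intro mult_left_mono) auto
    have g: "\<kappa> + Ln + 4 / 3 * d * y \<le> g"
    proof -
      have "\<kappa> = d * (d * y)" by (simp add: d2 power2_eq_square)
      moreover have "0 \<le> d * w" using d0 w0 by simp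
      ultimately show ?thesis using Ln2 dd dy unfolding g_def mult.assoc by linarith
    qed
    have dw0: "0 \<le> d * w" "d * w \<le> 475 / 10000 * w" using d0 w0 d_le u_le by (auto intro!: mult_right_mono)
    have g0: "0 \<le> g" using w0 dw0 by (simp add: g_def)
    have "n * \<kappa> + n * Ln + B \<le> n * (\<kappa> + Ln + 4 / 3 * d * y)" using B by (simp add: algebra_simps)
    also have "\<dots> \<le> n * g" using g n0 by (intro mult_left_mono) auto
    also have "\<dots> \<le> (z + 1) * g" using nz g0 by (intro mult_right_mono) auto
    also have "\<dots> = (1 + 7 * u) * Y + (1 + 7 * u) * (Y / w + 1411 / 1000 * d * Y) + g"
      using w0 by (simp add: z_def g_def field_simps)
    also have "\<dots> \<le> (1 + 7 * u) * Y + 1665 / 1000 * (1021 / 1000 * W + 1411 / 1000 * d * Y) + g"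
    proof -
      have "Y \<le> 1021 / 1000 * W * w" using mult_right_mono[OF yw, of W] W0 by (simp add: YW mult_ac)
      then have "Y / w \<le> 1021 / 1000 * W" using w0 by (simp add: pos_divide_le_eq)
      then have "(1 + 7 * u) * (Y / w + 1411 / 1000 * d * Y) \<le> 1665 / 1000 * (1021 / 1000 * W + 1411 / 1000 * d * Y)"
        using u_le u0 d0 Y0 w0 by (intro mult_mono add_mono) auto
      then show ?thesis by simp
    qed
    also have "g \<le> 2 * y" using dw0 w_le y300 by (simp add: g_def)
    also have "2 * y \<le> W" using y2 y3 yW y300 by linarith
    finally have 3: "n * \<kappa> + n * Ln + B \<le> Y + 7 * (u * Y) + 1665 / 1000 * (1021 / 1000 * W) + 1665 / 1000 * (1411 / 1000 * (d * Y)) + W"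
      by (simp add: algebra_simps)
    \<comment> \<open>The terms of size \<open>W = Y / y\<close> fit below \<open>s * Y\<close>,
      since \<open>s * y\<close> is the square root of \<open>y\<close>; so the summand
      \<open>sqrt m\<close> of the exponent covers them.\<close>
    have "17 * W \<le> (s * y) * W" using sy W0 by (intro mult_right_mono) auto
    then have sW: "17 * W \<le> s * Y" by (simp add: YW)
    have ln6: "ln 6 \<le> (5 :: real)" using ln_le_minus_one[of 6] by simp
    have sq: "1 \<le> sqrt \<mu>" using \<mu> by (simp add: real_le_rsqrt)
    have "s * Y \<le> sqrt \<mu> * (s * Y)" using sq s0 Y0 by simp
    moreover have "5 * (d * Y) + 8 * (u * Y) \<le> (4 + sqrt \<mu> + 8 * \<mu>) * (d * Y)"
    proof -
      have "1 * (d * Y) \<le> sqrt \<mu> * (d * Y)" using sq d0 Y0 by (intro mult_right_mono) auto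
      then show ?thesis by (simp add: u_def algebra_simps)
    qed
    moreover have "0 < d * Y" "0 < u * Y" using d0 u0 Y0 by auto
    ultimately have "ln 6 + n * \<kappa> + n * Ln + B < Y + sqrt \<mu> * (s * Y) + (4 + sqrt \<mu> + 8 * \<mu>) * (d * Y)"
      using 3 sW ln6 W1 by simp
    also have "\<dots> = Y + (sqrt \<mu> + (4 + sqrt \<mu> + 8 * \<mu>) * sqrt \<kappa>) * Y / sqrt y"
      by (simp add: d_s s_def add_divide_distrib distrib_right distrib_left mult.assoc)
    finally show "ln 6 + n * \<kappa> + n * ln n + 2 * \<kappa> * n ^ 2 / \<nu>
      < Y + (sqrt m + (4 + sqrt m + 8 * m) * sqrt \<kappa>) * Y / sqrt (ln Y)"
      by (simp add: B_def Ln_def \<mu>_def y_def)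
  qed
qed

section \<open>The lower bound\<close>

lemma g1_pos: "0 < g1 m \<alpha>"
proof -
  have "0 \<notin> (\<lambda>j. snd (quotient_of (\<alpha> j))) ` {0..m}"
  proof
    assume "0 \<in> (\<lambda>j. snd (quotient_of (\<alpha> j))) ` {0..m}"
    then obtain j where "0 = snd (quotient_of (\<alpha> j))" by (rule imageE)
    with quotient_of_denom_pos'[of "\<alpha> j"] show False by simp
  qed
  then have "g1 m \<alpha> \<noteq> 0" unfolding g1_def by (simp add: Lcm_0_iff)
  moreover have "0 \<le> g1 m \<alpha>" by (simp add: g1_def)
  ultimately show ?thesis by simp
qed

lemma exists_common_numerator:
  assumes "j \<le> m"
  shows "\<exists>a :: int. real_of_rat (\<alpha> j) = a / g1 m \<alpha>"
proof -
  obtain p d where pd: "quotient_of (\<alpha> j) = (p, d)" by (cases "quotient_of (\<alpha> j)")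
  have d: "0 < d" using quotient_of_denom_pos[OF pd] .
  have "snd (quotient_of (\<alpha> j)) dvd g1 m \<alpha>"
    unfolding g1_def by (intro dvd_Lcm imageI) (use assms in simp)
  then obtain e where e: "g1 m \<alpha> = d * e" unfolding pd snd_conv by (rule dvdE)
  then have e0: "e \<noteq> 0" using g1_pos[of m \<alpha>] by (intro notI) simp
  have "real_of_rat (\<alpha> j) = p / d" using quotient_of_div[OF pd] by (simp add: of_rat_divide)
  also have "\<dots> = real_of_int (p * e) / real_of_int (d * e)" using d e0 by simp
  finally show ?thesis unfolding e by (rule exI)
qed

lemma abs_le_g3_tilde:
  assumes "j \<le> m"
  shows "\<bar>real_of_rat (\<alpha> j)\<bar> \<le> real_of_rat (g3_tilde m \<alpha>)" and "1 \<le> real_of_rat (g3_tilde m \<alpha>)"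
proof -
  have "\<bar>\<alpha> j\<bar> \<le> g3 m \<alpha>" unfolding g3_def by (rule Max_ge) (use assms in auto)
  then have "\<bar>\<alpha> j\<bar> \<le> g3_tilde m \<alpha>" by (simp add: g3_tilde_def)
  then have "\<alpha> j \<le> g3_tilde m \<alpha>" "- \<alpha> j \<le> g3_tilde m \<alpha>" by (simp_all only: abs_le_iff)
  then have "real_of_rat (\<alpha> j) \<le> real_of_rat (g3_tilde m \<alpha>)"
    "real_of_rat (- \<alpha> j) \<le> real_of_rat (g3_tilde m \<alpha>)" by (simp_all only: of_rat_less_eq)
  then show "\<bar>real_of_rat (\<alpha> j)\<bar> \<le> real_of_rat (g3_tilde m \<alpha>)"
    by (simp only: abs_le_iff of_rat_minus)
  show "1 \<le> real_of_rat (g3_tilde m \<alpha>)" by (simp add: g3_tilde_def)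
qed

text \<open>The term with \<open>sqrt (log_2g1g3 m \<alpha>)\<close> is absorbed by \<open>c s \<le> 8 s\<^sup>2 + c\<^sup>2 / 32\<close>.\<close>

lemma AKT_le_SA:
  assumes m: "2 \<le> m" and L: "0 \<le> log_2g1g3 m \<alpha>"
  shows "sqrt (real m) + (4 + sqrt (real m) + 8 * real m) * sqrt (log_2g1g3 m \<alpha>) \<le> A_SA m \<alpha>"
proof -
  define x where "x = real m"
  define s where "s = sqrt (log_2g1g3 m \<alpha>)"
  have x: "2 \<le> x" using m by (simp add: x_def)
  have s: "0 \<le> s" "log_2g1g3 m \<alpha> = s\<^sup>2" using L by (simp_all add: s_def)
  have sx: "sqrt x \<le> x" using x by (simp add: real_le_lsqrt power2_eq_square)
  define c where "c = 4 + 9 * x"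
  have "(4 + sqrt x + 8 * x) * s \<le> c * s" using sx s by (intro mult_right_mono) (auto simp: c_def)
  also have "\<dots> \<le> 8 * s\<^sup>2 + c\<^sup>2 / 32"
  proof -
    have "(16 * s - c)\<^sup>2 = 256 * s\<^sup>2 - 32 * (c * s) + c\<^sup>2" by (simp add: power2_diff power_mult_distrib)
    with zero_le_power2[of "16 * s - c"] show ?thesis by linarith
  qed
  \<comment> \<open>One \<open>x\<close> of the available \<open>39 * x\<close> is kept back to
    cover \<open>sqrt x\<close>.\<close>
  also have "c\<^sup>2 / 32 \<le> 16 * x\<^sup>2 + 38 * x + 12"
  proof -
    have "c\<^sup>2 = 16 + 72 * x + 81 * x\<^sup>2" by (simp add: c_def power2_sum power_mult_distrib)
    with x zero_le_power2[of x] show ?thesis by linarith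
  qed
  finally have 1: "sqrt x + (4 + sqrt x + 8 * x) * s \<le> 8 * s\<^sup>2 + 16 * x\<^sup>2 + 39 * x + 12" using sx by simp
  have 2: "0 \<le> x * ln (2 * x)" using x by simp
  have "8 * s\<^sup>2 \<le> (8 + 4 / x + 1 / (3 * x ^ 2)) * s\<^sup>2"
    using x by (intro mult_right_mono) auto
  with 1 2 show ?thesis by (simp add: A_SA_def s x_def[symmetric] s_def[symmetric])
qed

theorem theorem2p5:
  fixes m :: nat and \<alpha> :: "nat \<Rightarrow> rat"
  assumes "m \<ge> 2"
    and "\<alpha> 0 = 0"
    and "inj_on \<alpha> {0..m}"
  shows "\<exists>A_AKT :: real.
    A_AKT \<le> sqrt (real m) + (4 + sqrt (real m) + 8 * real m) * sqrt (log_2g1g3 m \<alpha>) \<and>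
    (\<forall>(\<beta> :: nat \<Rightarrow> int) (H :: nat \<Rightarrow> real).
       (\<exists>j\<in>{0..m}. \<beta> j \<noteq> 0) \<longrightarrow>
       (\<forall>i\<in>{1..m}. H i \<ge> max 1 \<bar>real_of_int (\<beta> i)\<bar>) \<longrightarrow>
       (\<Prod>i=1..m. H i) \<ge> H0_AKT m \<alpha> \<longrightarrow>
       \<bar>\<Sum>j=0..m. real_of_int (\<beta> j) * exp (real_of_rat (\<alpha> j))\<bar>
         > (\<Prod>i=1..m. H i) powr (- 1 - A_AKT / sqrt (ln (ln (\<Prod>i=1..m. H i))))) \<and>
    A_AKT \<le> A_SA m \<alpha>"
proof -
  define q where "q = g1 m \<alpha>"
  define G where "G = real_of_rat (g3_tilde m \<alpha>)"
  \<comment> \<open>The numerators over the common denominator \<open>q\<close> are at most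
    \<open>q * G\<close>, which is at least 1; hence twice this number also bounds
    \<open>1 + \<bar>a j\<bar>\<close>.\<close>
  define Q where "Q = 2 * real_of_int q * G"
  define \<kappa> where "\<kappa> = ln Q"
  have \<kappa>_eq: "log_2g1g3 m \<alpha> = \<kappa>" by (simp add: log_2g1g3_def \<kappa>_def Q_def q_def G_def)
  have q: "0 < q" using g1_pos by (simp add: q_def)
  have q1: "1 \<le> real_of_int q" using q by simp
  have G: "1 \<le> G" using abs_le_g3_tilde(2)[of 0 m \<alpha>] by (simp add: G_def)
  have qG: "1 \<le> q * G" using mult_mono[OF q1 G] q1 by simp
  have Q2: "2 \<le> Q" using qG by (simp add: Q_def)
  have qQ: "q \<le> Q" using mult_left_mono[OF G, of q] q1 qG unfolding Q_def by linarith
  have \<kappa>23: "2 / 3 \<le> \<kappa>"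
  proof -
    have "ln 2 \<le> \<kappa>" unfolding \<kappa>_def using Q2 by (intro ln_mono) auto
    moreover have "2 / 3 \<le> ln (2 :: real)"
    proof -
      \<comment> \<open>157/144 is 1 + 1/12 + 1/144, and its eighth power is still below 2.\<close>
      have "exp (1 / 12 :: real) \<le> 157 / 144" using exp_bound[of "1 / 12"] by (simp add: power2_eq_square)
      then have "exp (1 / 12 :: real) ^ 8 \<le> (157 / 144) ^ 8" by (intro power_mono) auto
      moreover have "exp (1 / 12 :: real) ^ 8 = exp (2 / 3)" by (simp flip: exp_of_nat_mult)
      moreover have "(157 / 144 :: real) ^ 8 \<le> 2" by (simp add: power_divide)
      ultimately have "exp (2 / 3 :: real) \<le> 2" by linarith
      then have "ln (exp (2 / 3 :: real)) \<le> ln 2" by (intro ln_mono) auto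
      then show ?thesis by simp
    qed
    ultimately show ?thesis by simp
  qed
  have "\<exists>a :: nat \<Rightarrow> int. \<forall>j\<in>{..m}. real_of_rat (\<alpha> j) = a j / q"
    unfolding q_def by (intro bchoice ballI exists_common_numerator) simp
  then obtain a :: "nat \<Rightarrow> int" where a: "\<And>j. j \<le> m \<Longrightarrow> real_of_rat (\<alpha> j) = a j / q" by auto
  have a0: "a 0 = 0" using a[of 0] assms(2) q by simp
  have inj: "inj_on a {..m}"
  proof (rule inj_onI)
    fix i j assume ij: "i \<in> {..m}" "j \<in> {..m}" "a i = a j"
    then have "real_of_rat (\<alpha> i) = real_of_rat (\<alpha> j)" using a[of i] a[of j] by simp
    then have "\<alpha> i = \<alpha> j" by simp
    with ij assms(3) show "i = j" by (auto simp: inj_on_def)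
  qed
  have aQ: "1 + real_of_int \<bar>a j\<bar> \<le> Q" if "1 \<le> j" "j \<le> m" for j
  proof -
    have "\<bar>a j / q\<bar> \<le> G" using abs_le_g3_tilde(1)[of j m \<alpha>] a[of j] that by (simp add: G_def)
    then have "\<bar>real_of_int (a j)\<bar> \<le> q * G" using q by (simp add: abs_divide pos_divide_le_eq mult.commute)
    with qG show ?thesis by (simp add: Q_def)
  qed
  \<comment> \<open>The witness is the upper bound itself.\<close>
  define A where "A = sqrt m + (4 + sqrt m + 8 * m) * sqrt \<kappa>"
  have main: "(\<Prod>i=1..m. H i) powr (- 1 - A / sqrt (ln (ln (\<Prod>i=1..m. H i))))
      < \<bar>\<Sum>j=0..m. real_of_int (\<beta> j) * exp (real_of_rat (\<alpha> j))\<bar>"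
    if \<beta>: "\<exists>j\<in>{0..m}. \<beta> j \<noteq> 0" and H: "\<forall>i\<in>{1..m}. H i \<ge> max 1 \<bar>real_of_int (\<beta> i)\<bar>"
      and H0: "(\<Prod>i=1..m. H i) \<ge> H0_AKT m \<alpha>" for \<beta> :: "nat \<Rightarrow> int" and H :: "nat \<Rightarrow> real"
  proof -
    define P where "P = (\<Prod>i=1..m. H i)"
    define Y where "Y = ln P"
    define L where "L = (\<Sum>j\<le>m. \<beta> j * exp (a j / q))"
    have L: "L = (\<Sum>j=0..m. real_of_int (\<beta> j) * exp (real_of_rat (\<alpha> j)))"
      unfolding L_def atMost_atLeast0 by (intro sum.cong) (auto simp: a)
    have P: "exp (56 * real m ^ 2 * \<kappa> * exp (111 * real m ^ 2 * \<kappa>)) \<le> P"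
      using H0 by (simp add: P_def H0_AKT_def \<kappa>_eq)
    have P0: "0 < P" using P by (rule less_le_trans[OF exp_gt_zero])
    have Y: "56 * real m ^ 2 * \<kappa> * exp (111 * real m ^ 2 * \<kappa>) \<le> Y"
      using P P0 by (simp add: Y_def ln_ge_iff)
    obtain n \<nu> :: nat where n: "exp \<kappa> \<le> n * \<kappa>" "2 * m \<le> n" and \<nu>: "1 \<le> \<nu>" "\<nu> + m ^ 2 \<le> n" and
      I: "Y + m * (2 * \<kappa> * n ^ 2 / \<nu> + 7 * n * \<kappa>) + (m * (\<nu> + m ^ 2) + m + \<nu>) * ln n \<le> (n + 1) * ln n" and
      II: "ln 6 + n * \<kappa> + n * ln n + 2 * \<kappa> * n ^ 2 / \<nu>
        < Y + (sqrt m + (4 + sqrt m + 8 * m) * sqrt \<kappa>) * Y / sqrt (ln Y)"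
      by (rule parameter_choice[OF assms(1) \<kappa>23 Y])
    obtain j0 where j0: "j0 \<le> m" "\<beta> j0 \<noteq> 0" using \<beta> by auto
    have Qn: "Q \<le> n * ln Q" using n(1) Q2 by (simp add: \<kappa>_def)
    have m1: "1 \<le> m" using assms(1) by simp
    have Hj: "max 1 \<bar>real_of_int (\<beta> j)\<bar> \<le> H j" if "1 \<le> j" "j \<le> m" for j using H that by simp
    define B where "B = 2 * \<kappa> * n ^ 2 / \<nu>"
    have I': "Y + m * (2 * \<kappa> * real n ^ 2 / \<nu> + 7 * real n * \<kappa>) + real (m * (\<nu> + m ^ 2) + m + \<nu>) * ln n
        \<le> (real n + 1) * ln n"
      using I by (simp add: add.commute)
    have "1 \<le> 6 * Q ^ n * real n ^ n * exp (2 * ln Q * real n ^ 2 / \<nu>) * \<bar>L\<bar>"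
      unfolding L_def
      by (rule linear_form_bound_of_parameters[of a m q Q n \<nu> j0 \<beta> H, OF inj a0 q qQ aQ Q2 Qn n(2) m1 \<nu> j0 Hj I'[unfolded Y_def P_def \<kappa>_def]])
    also have "6 * Q ^ n * real n ^ n * exp (2 * ln Q * real n ^ 2 / \<nu>) = exp (ln 6 + n * \<kappa> + n * ln n + B)"
    proof -
      have "0 < real n" using n(2) assms(1) by simp
      then show ?thesis using Q2 by (simp add: exp_add exp_of_nat_mult \<kappa>_def B_def)
    qed
    finally have one: "1 \<le> exp (ln 6 + n * \<kappa> + n * ln n + B) * \<bar>L\<bar>" .
    have "exp (- (ln 6 + n * \<kappa> + n * ln n + B)) * 1
        \<le> exp (- (ln 6 + n * \<kappa> + n * ln n + B)) * (exp (ln 6 + n * \<kappa> + n * ln n + B) * \<bar>L\<bar>)"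
      using one by (rule mult_left_mono) simp
    also have "\<dots> = \<bar>L\<bar>"
      unfolding mult.assoc[symmetric] exp_add[symmetric] by simp
    finally have "exp (- (ln 6 + n * \<kappa> + n * ln n + B)) \<le> \<bar>L\<bar>" by simp
    \<comment> \<open>In exponential form the claim compares two exponents, and \<open>II\<close> is
      exactly this comparison.\<close>
    moreover have "P powr (- 1 - A / sqrt (ln (ln P))) = exp (- (Y + A * Y / sqrt (ln Y)))"
      using P0 by (simp add: powr_def Y_def algebra_simps)
    moreover have "exp (- (Y + A * Y / sqrt (ln Y))) < exp (- (ln 6 + n * \<kappa> + n * ln n + B))"
      using II by (simp add: A_def B_def)
    ultimately show ?thesis unfolding L P_def by linarith
  qed
  show ?thesis
  proof (intro exI[of _ A] conjI allI impI)
    show "A \<le> sqrt (real m) + (4 + sqrt (real m) + 8 * real m) * sqrt (log_2g1g3 m \<alpha>)"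
      by (simp add: A_def \<kappa>_eq)
    show "A \<le> A_SA m \<alpha>"
      using AKT_le_SA[OF assms(1), of \<alpha>] \<kappa>23 by (simp add: A_def \<kappa>_eq)
  qed (rule main)
qed

end
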